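(* Let $K\colon P\to\mathbf{SCpx}$ be a poset tower and let $\ell\ge 0$. Then there exists a $\overline P$-filtered graph $\mathcal G\colon\overline P\to\Delta\mathbf{Cpx}_{\le 1}$, where each vertex and each edge is born at a unique grade $x\in\overline P$, with $\overline P$-graded boundary matrix $\overline p_\ell^1$ and with a distinguished vertex $\Omega$ born at $-\infty$, such that the matrix $p_\ell^1$, obtained from $\overline p_\ell^1$ by removing the row corresponding to $\Omega$, is a minimal presentation of $C_\ell(K)$.
   Context: $P$ is a finite poset, viewed as a category, and $\overline P=P\cup\{-\infty\}$ with $-\infty<x$ for all $x\in P$. $\mathbf{Vec}$ is the category of finite-dimensional $\mathbb F_2$-vector spaces; $\mathbf{SCpx}$ is the category of finite simplicial complexes and simplicial maps; $\Delta\mathbf{Cpx}_{\le1}$ is the category of finite one-dimensional $\Delta$-complexes (graphs, multiple edges allowed). A poset tower is a functor $K\colon P\to\mathbf{SCpx}$. A $\overline P$-filtered graph is a functor $\mathcal G\colon\overline P\to\Delta\mathbf{Cpx}_{\le1}$ all of whose maps are inclusions; a vertex or edge is born at a unique grade $x$ if it is present in $\mathcal G(y)$ exactly for $y\ge x$. Its $\overline P$-graded boundary matrix over $\mathbb F_2$ has rows indexed by the vertices and columns by the edges, labeled with their birth grades, each column having entries $1$ in the rows of the two endpoints of the edge. A $P$-persistence module is a functor $P\to\mathbf{Vec}$. $C_\ell(K)$ is the $P$-persistence module such that $C_\ell(K)(x)$ has as basis the $\ell$-simplices of $K(x)$ and $C_\ell(K)(x\le y)$ sends $\sigma$ to $K(x\le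 y)(\sigma)$ if this is an $\ell$-simplex and to $0$ otherwise. The elementary projective module $\operatorname{Proj}[x]$ is $\mathbb F_2$ at all $y\ge x$ and $0$ elsewhere, with identity maps between nonzero spaces; projective modules are finite direct sums of these. A $P$-graded matrix with columns labeled by grades $x_i\in P$, rows labeled by grades $y_j\in P$, and entries $\lambda_{ji}\in\mathbb F_2$ with $\lambda_{ji}=0$ unless $y_j\le x_i$ is the same as a morphism $\bigoplus_i\operatorname{Proj}[x_i]\to\bigoplus_j\operatorname{Proj}[y_j]$. A presentation of $M$ is an exact sequence $0\leftarrow M\leftarrow Q_0\xleftarrow{q_1}Q_1$ with $Q_0,Q_1$ projective (the matrix $q_1$ is also called the presentation; $M\cong\operatorname{coker}q_1$); it is minimal if $Q_0$ and $Q_1$ minimize the number of elementary projective summands. *)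

theory Defs
  imports
    Complex_Main
    "HOL-Library.Poly_Mapping"
    "HOL-Library.Z2"
    "HOL-Library.Option_ord"
begin

section \<open>Vector spaces over the field with two elements\<close>

text \<open>The field is the library type \<open>bit\<close>. All vector spaces are subspaces of free spaces
  \<open>'b \<Rightarrow>\<^sub>0 bit\<close> (finitely supported functions), which loses no generality up to isomorphism.\<close>

definition scale :: "bit \<Rightarrow> ('b \<Rightarrow>\<^sub>0 bit) \<Rightarrow> ('b \<Rightarrow>\<^sub>0 bit)" where
  "scale a v = Poly_Mapping.map ((*) a) v"

lemma lookup_scale: "Poly_Mapping.lookup (scale a v) b = a * Poly_Mapping.lookup v b"
  unfolding scale_def by transfer (auto simp: when_def)

interpretation F2: vector_space scale
  by unfold_locales
    (auto intro!: poly_mapping_eqI simp: lookup_scale Poly_Mapping.lookup_add algebra_simps)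

definition basis_vec :: "'b \<Rightarrow> ('b \<Rightarrow>\<^sub>0 bit)" where
  "basis_vec b = Poly_Mapping.single b 1"

definition free_on :: "'b set \<Rightarrow> ('b \<Rightarrow>\<^sub>0 bit) set" where
  "free_on B = {v. Poly_Mapping.keys v \<subseteq> B}"

definition linear_extension :: "('b \<Rightarrow> ('c \<Rightarrow>\<^sub>0 bit)) \<Rightarrow> ('b \<Rightarrow>\<^sub>0 bit) \<Rightarrow> ('c \<Rightarrow>\<^sub>0 bit)" where
  "linear_extension \<phi> v = (\<Sum>b\<in>Poly_Mapping.keys v. scale (Poly_Mapping.lookup v b) (\<phi> b))"

definition linear_between ::
    "('b \<Rightarrow>\<^sub>0 bit) set \<Rightarrow> ('c \<Rightarrow>\<^sub>0 bit) set \<Rightarrow> (('b \<Rightarrow>\<^sub>0 bit) \<Rightarrow> ('c \<Rightarrow>\<^sub>0 bit)) \<Rightarrow> bool" where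
  "linear_between V W f \<longleftrightarrow>
     f ` V \<subseteq> W \<and>
     (\<forall>u\<in>V. \<forall>v\<in>V. f (u + v) = f u + f v) \<and>
     (\<forall>a. \<forall>v\<in>V. f (scale a v) = scale a (f v))"

definition finite_dim_space :: "('b \<Rightarrow>\<^sub>0 bit) set \<Rightarrow> bool" where
  "finite_dim_space V \<longleftrightarrow> F2.subspace V \<and> (\<exists>B. finite B \<and> F2.span B = V)"

section \<open>Poset towers\<close>

text \<open>A poset is a subset \<open>P\<close> of a partially ordered type, with the induced order.\<close>

definition simplicial_complex :: "'v set set \<Rightarrow> bool" where
  "simplicial_complex S \<longleftrightarrow>
     finite S \<and> (\<forall>\<sigma>\<in>S. finite \<sigma> \<and> \<sigma> \<noteq> {}) \<and> (\<forall>\<sigma>\<in>S. \<forall>\<tau>. \<tau> \<subseteq> \<sigma> \<and> \<tau> \<noteq> {} \<longrightarrow> \<tau> \<in> S)"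

definition simplices :: "nat \<Rightarrow> 'v set set \<Rightarrow> 'v set set" where
  "simplices l S = {\<sigma> \<in> S. card \<sigma> = Suc l}"

text \<open>The vertices of \<open>S\<close> are the elements of \<open>\<Union>S\<close>; vertex maps are only relevant there.\<close>

definition simplicial_map :: "'v set set \<Rightarrow> 'w set set \<Rightarrow> ('v \<Rightarrow> 'w) \<Rightarrow> bool" where
  "simplicial_map S T f \<longleftrightarrow> (\<forall>\<sigma>\<in>S. f ` \<sigma> \<in> T)"

record ('p, 'v) tower =
  complex_at :: "'p \<Rightarrow> 'v set set"
  vertex_map :: "'p \<Rightarrow> 'p \<Rightarrow> 'v \<Rightarrow> 'v"

definition poset_tower :: "'p::order set \<Rightarrow> ('p, 'v) tower \<Rightarrow> bool" where
  "poset_tower P K \<longleftrightarrow>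
     (\<forall>x\<in>P. simplicial_complex (complex_at K x)) \<and>
     (\<forall>x\<in>P. \<forall>y\<in>P. x \<le> y \<longrightarrow>
        simplicial_map (complex_at K x) (complex_at K y) (vertex_map K x y)) \<and>
     (\<forall>x\<in>P. \<forall>v\<in>\<Union>(complex_at K x). vertex_map K x x v = v) \<and>
     (\<forall>x\<in>P. \<forall>y\<in>P. \<forall>z\<in>P. x \<le> y \<and> y \<le> z \<longrightarrow>
        (\<forall>v\<in>\<Union>(complex_at K x). vertex_map K y z (vertex_map K x y v) = vertex_map K x z v))"

section \<open>Persistence modules\<close>

record ('p, 'b) pmodule =
  space_at :: "'p \<Rightarrow> ('b \<Rightarrow>\<^sub>0 bit) set"
  trans_map :: "'p \<Rightarrow> 'p \<Rightarrow> ('b \<Rightarrow>\<^sub>0 bit) \<Rightarrow> ('b \<Rightarrow>\<^sub>0 bit)"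

definition persistence_module :: "'p::order set \<Rightarrow> ('p, 'b) pmodule \<Rightarrow> bool" where
  "persistence_module P M \<longleftrightarrow>
     (\<forall>x\<in>P. finite_dim_space (space_at M x)) \<and>
     (\<forall>x\<in>P. \<forall>y\<in>P. x \<le> y \<longrightarrow>
        linear_between (space_at M x) (space_at M y) (trans_map M x y)) \<and>
     (\<forall>x\<in>P. \<forall>v\<in>space_at M x. trans_map M x x v = v) \<and>
     (\<forall>x\<in>P. \<forall>y\<in>P. \<forall>z\<in>P. x \<le> y \<and> y \<le> z \<longrightarrow>
        (\<forall>v\<in>space_at M x. trans_map M y z (trans_map M x y v) = trans_map M x z v))"

definition pmodule_morphism :: "'p::order set \<Rightarrow> ('p, 'b) pmodule \<Rightarrow> ('p, 'c) pmodule \<Rightarrow>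
    ('p \<Rightarrow> ('b \<Rightarrow>\<^sub>0 bit) \<Rightarrow> ('c \<Rightarrow>\<^sub>0 bit)) \<Rightarrow> bool" where
  "pmodule_morphism P M N f \<longleftrightarrow>
     persistence_module P M \<and> persistence_module P N \<and>
     (\<forall>x\<in>P. linear_between (space_at M x) (space_at N x) (f x)) \<and>
     (\<forall>x\<in>P. \<forall>y\<in>P. x \<le> y \<longrightarrow>
        (\<forall>v\<in>space_at M x. f y (trans_map M x y v) = trans_map N x y (f x v)))"

definition chain_module :: "nat \<Rightarrow> ('p, 'v) tower \<Rightarrow> ('p, 'v set) pmodule" where
  "chain_module l K =
     \<lparr>space_at = (\<lambda>x. free_on (simplices l (complex_at K x))),
      trans_map = (\<lambda>x y. linear_extension (\<lambda>\<sigma>.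
        if vertex_map K x y ` \<sigma> \<in> simplices l (complex_at K y)
        then basis_vec (vertex_map K x y ` \<sigma>) else 0))\<rparr>"

text \<open>The direct sum of \<open>Proj[g i]\<close> over \<open>i \<in> I\<close>; the basis vector of \<open>i\<close> spans
  the summand \<open>Proj[g i]\<close> at every grade \<open>y \<ge> g i\<close>. The transition maps are
  the inclusions of the spaces involved.\<close>

definition proj_sum :: "'i set \<Rightarrow> ('i \<Rightarrow> 'p::order) \<Rightarrow> ('p, 'i) pmodule" where
  "proj_sum I g =
     \<lparr>space_at = (\<lambda>y. free_on {i \<in> I. g i \<le> y}),
      trans_map = (\<lambda>x y v. v)\<rparr>"

lemma linear_extension_superset:
  assumes "finite B" "Poly_Mapping.keys v \<subseteq> B"
  shows "linear_extension \<phi> v = (\<Sum>b\<in>B. scale (Poly_Mapping.lookup v b) (\<phi> b))"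
  unfolding linear_extension_def
  by (rule sum.mono_neutral_left) (use assms in \<open>auto simp: Poly_Mapping.in_keys_iff\<close>)

lemma keys_scale: "Poly_Mapping.keys (scale a v) \<subseteq> Poly_Mapping.keys v"
  by (auto simp: Poly_Mapping.in_keys_iff lookup_scale)

lemma linear_extension_add:
  "linear_extension \<phi> (u + v) = linear_extension \<phi> u + linear_extension \<phi> v"
proof -
  have B: "finite (Poly_Mapping.keys u \<union> Poly_Mapping.keys v)"
    "Poly_Mapping.keys (u + v) \<subseteq> Poly_Mapping.keys u \<union> Poly_Mapping.keys v"
    using Poly_Mapping.keys_add[of u v] by auto
  show ?thesis
    using B
    by (simp only: linear_extension_superset[OF B(1)] Un_upper1 Un_upper2
        Poly_Mapping.lookup_add F2.scale_left_distrib sum.distrib)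
qed

lemma linear_extension_scale:
  "linear_extension \<phi> (scale a v) = scale a (linear_extension \<phi> v)"
  by (subst (1 2) linear_extension_superset[where B = "Poly_Mapping.keys v"])
    (use keys_scale[of a v] in \<open>auto simp: lookup_scale F2.scale_sum_right\<close>)

lemma linear_extension_basis_vec: "linear_extension \<phi> (basis_vec b) = \<phi> b"
  by (simp add: linear_extension_def basis_vec_def)

lemma subspace_free_on: "F2.subspace (free_on B)"
  unfolding F2.subspace_def free_on_def mem_Collect_eq
proof (intro conjI ballI allI impI)
  show "Poly_Mapping.keys (u + v) \<subseteq> B"
    if "u \<in> {v. Poly_Mapping.keys v \<subseteq> B}" "v \<in> {v. Poly_Mapping.keys v \<subseteq> B}" for u v
    using that Poly_Mapping.keys_add[of u v] by auto
  show "Poly_Mapping.keys (scale a v) \<subseteq> B" if "v \<in> {v. Poly_Mapping.keys v \<subseteq> B}" for a v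
    using that keys_scale[of a v] by auto
qed simp

lemma basis_vec_in_free_on: "b \<in> B \<Longrightarrow> basis_vec b \<in> free_on B"
  by (simp add: basis_vec_def free_on_def)

lemma basis_vec_decomposition:
  "v = (\<Sum>b\<in>Poly_Mapping.keys v. scale (Poly_Mapping.lookup v b) (basis_vec b))"
  (is "v = ?w")
proof (rule poly_mapping_eqI)
  fix c
  have "Poly_Mapping.lookup ?w c =
      (\<Sum>b\<in>Poly_Mapping.keys v. if b = c then Poly_Mapping.lookup v c else 0)"
    unfolding Poly_Mapping.lookup_sum
    by (rule sum.cong)
      (auto simp: lookup_scale basis_vec_def Poly_Mapping.lookup_single when_def)
  also have "\<dots> = Poly_Mapping.lookup v c"
    by (subst sum.delta) (auto simp: Poly_Mapping.in_keys_iff)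
  finally show "Poly_Mapping.lookup v c = Poly_Mapping.lookup ?w c" ..
qed

lemma finite_dim_space_free_on:
  assumes "finite B"
  shows "finite_dim_space (free_on B)"
  unfolding finite_dim_space_def
proof (intro conjI exI)
  show "F2.subspace (free_on B)" by (rule subspace_free_on)
  show "finite (basis_vec ` B)" using assms by simp
  show "F2.span (basis_vec ` B) = free_on B"
  proof
    show "F2.span (basis_vec ` B) \<subseteq> free_on B"
      by (rule F2.span_minimal) (auto simp: subspace_free_on basis_vec_in_free_on)
    show "free_on B \<subseteq> F2.span (basis_vec ` B)"
    proof
      fix v assume v: "v \<in> free_on B"
      have "(\<Sum>b\<in>Poly_Mapping.keys v. scale (Poly_Mapping.lookup v b) (basis_vec b))
          \<in> F2.span (basis_vec ` B)"
        by (intro F2.span_sum F2.span_scale F2.span_base) (use v in \<open>auto simp: free_on_def\<close>)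
      then show "v \<in> F2.span (basis_vec ` B)"
        using basis_vec_decomposition[of v] by simp
    qed
  qed
qed

lemma linear_between_linear_extension:
  assumes "\<And>b. b \<in> B \<Longrightarrow> \<phi> b \<in> free_on C"
  shows "linear_between (free_on B) (free_on C) (linear_extension \<phi>)"
  unfolding linear_between_def
proof (intro conjI ballI allI)
  show "linear_extension \<phi> ` free_on B \<subseteq> free_on C"
    unfolding linear_extension_def
    by (auto intro!: F2.subspace_sum F2.subspace_scale subspace_free_on assms simp: free_on_def[of B])
qed (auto simp: linear_extension_add linear_extension_scale)

lemma linear_extension_id:
  assumes "v \<in> free_on B" "\<And>b. b \<in> B \<Longrightarrow> \<phi> b = basis_vec b"
  shows "linear_extension \<phi> v = v"
proof -
  have "linear_extension \<phi> v
      = (\<Sum>b\<in>Poly_Mapping.keys v. scale (Poly_Mapping.lookup v b) (basis_vec b))"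
    unfolding linear_extension_def
    by (rule sum.cong) (use assms in \<open>auto simp: free_on_def\<close>)
  then show ?thesis using basis_vec_decomposition[of v] by simp
qed

lemma linear_extension_sum:
  "linear_extension \<phi> (\<Sum>b\<in>A. f b) = (\<Sum>b\<in>A. linear_extension \<phi> (f b))"
  by (induction A rule: infinite_finite_induct)
    (auto simp: linear_extension_add, auto simp: linear_extension_def)

lemma linear_extension_compose:
  assumes "v \<in> free_on B" "\<And>b. b \<in> B \<Longrightarrow> linear_extension \<psi> (\<phi> b) = \<chi> b"
  shows "linear_extension \<psi> (linear_extension \<phi> v) = linear_extension \<chi> v"
proof -
  have "linear_extension \<psi> (linear_extension \<phi> v)
      = (\<Sum>b\<in>Poly_Mapping.keys v. scale (Poly_Mapping.lookup v b) (linear_extension \<psi> (\<phi> b)))"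
    by (simp add: linear_extension_def[of \<phi>] linear_extension_sum linear_extension_scale)
  also have "\<dots> = linear_extension \<chi> v"
    unfolding linear_extension_def[of \<chi>]
    by (rule sum.cong) (use assms in \<open>auto simp: free_on_def\<close>)
  finally show ?thesis .
qed

lemma persistence_module_chain_module:
  assumes K: "poset_tower P K"
  shows "persistence_module P (chain_module l K)"
proof -
  let ?X = "\<lambda>x. simplices l (complex_at K x)"
  let ?f = "vertex_map K"
  let ?\<phi> = "\<lambda>x y \<sigma>. if ?f x y ` \<sigma> \<in> ?X y then basis_vec (?f x y ` \<sigma>) else 0"
  have id: "?f x x ` \<sigma> = \<sigma>" if "x \<in> P" "\<sigma> \<in> ?X x" for x \<sigma>
  proof -
    have "\<forall>v\<in>\<sigma>. ?f x x v = v"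
      using K that by (auto simp: poset_tower_def simplices_def)
    then show ?thesis by force
  qed
  have comp: "linear_extension (?\<phi> y z) (?\<phi> x y \<sigma>) = ?\<phi> x z \<sigma>"
    if xyz: "x \<in> P" "y \<in> P" "z \<in> P" "x \<le> y" "y \<le> z" and \<sigma>: "\<sigma> \<in> ?X x" for x y z \<sigma>
  proof -
    have "\<forall>v\<in>\<sigma>. ?f y z (?f x y v) = ?f x z v"
      using K xyz \<sigma> unfolding poset_tower_def simplices_def by blast
    then have eq: "?f y z ` ?f x y ` \<sigma> = ?f x z ` \<sigma>" by (force simp: image_image)
    show ?thesis
    proof (cases "?f x y ` \<sigma> \<in> ?X y")
      case True
      then show ?thesis using eq by (simp add: linear_extension_basis_vec)
    next
      case False
      have mem: "?f x y ` \<sigma> \<in> complex_at K y" "finite \<sigma>" "card \<sigma> = Suc l"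
        using K xyz \<sigma>
        by (auto simp: poset_tower_def simplices_def simplicial_map_def simplicial_complex_def)
      then have "card (?f x y ` \<sigma>) < Suc l"
        using False card_image_le[of \<sigma> "?f x y"] by (auto simp: simplices_def)
      moreover have "card (?f y z ` ?f x y ` \<sigma>) \<le> card (?f x y ` \<sigma>)"
        using mem by (intro card_image_le) auto
      ultimately have "?f x z ` \<sigma> \<notin> ?X z" using eq by (auto simp: simplices_def)
      with False show ?thesis by (simp add: linear_extension_def)
    qed
  qed
  show ?thesis
    unfolding persistence_module_def chain_module_def pmodule.simps
  proof (intro conjI ballI impI)
    fix x assume "x \<in> P"
    then have "finite (?X x)"
      using K by (auto simp: poset_tower_def simplicial_complex_def simplices_def)
    then show "finite_dim_space (free_on (?X x))" by (rule finite_dim_space_free_on)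
  next
    fix x y
    show "linear_between (free_on (?X x)) (free_on (?X y)) (linear_extension (?\<phi> x y))"
      by (rule linear_between_linear_extension)
        (auto simp: basis_vec_in_free_on F2.subspace_0 subspace_free_on)
  next
    fix x v assume "x \<in> P" "v \<in> free_on (?X x)"
    then show "linear_extension (?\<phi> x x) v = v"
      by (intro linear_extension_id[where B = "?X x"]) (auto simp: id)
  next
    fix x y z v
    assume "x \<in> P" "y \<in> P" "z \<in> P" "x \<le> y \<and> y \<le> z" "v \<in> free_on (?X x)"
    then show "linear_extension (?\<phi> y z) (linear_extension (?\<phi> x y) v) =
        linear_extension (?\<phi> x z) v"
      by (intro linear_extension_compose[where B = "?X x"] comp) auto
  qed
qed

lemma persistence_module_proj_sum:
  assumes "finite I"
  shows "persistence_module P (proj_sum I g)"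
proof -
  have "free_on {i \<in> I. g i \<le> x} \<subseteq> free_on {i \<in> I. g i \<le> y}" if "x \<le> y" for x y
    using that by (auto simp: free_on_def intro: order_trans)
  then show ?thesis
    using assms
    by (auto simp: persistence_module_def proj_sum_def linear_between_def
        intro!: finite_dim_space_free_on)
qed

section \<open>Presentations\<close>

definition projective_presentation :: "'p::order set \<Rightarrow> ('p, 'b) pmodule \<Rightarrow>
    'j set \<Rightarrow> ('j \<Rightarrow> 'p) \<Rightarrow> 'i set \<Rightarrow> ('i \<Rightarrow> 'p) \<Rightarrow>
    ('p \<Rightarrow> ('i \<Rightarrow>\<^sub>0 bit) \<Rightarrow> ('j \<Rightarrow>\<^sub>0 bit)) \<Rightarrow> bool" where
  "projective_presentation P M J h I g q1 \<longleftrightarrow>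
     finite J \<and> h ` J \<subseteq> P \<and> finite I \<and> g ` I \<subseteq> P \<and>
     pmodule_morphism P (proj_sum I g) (proj_sum J h) q1 \<and>
     (\<exists>q0. pmodule_morphism P (proj_sum J h) M q0 \<and>
        (\<forall>x\<in>P. q0 x ` space_at (proj_sum J h) x = space_at M x \<and>
               {v \<in> space_at (proj_sum J h) x. q0 x v = 0}
                 = q1 x ` space_at (proj_sum I g) x))"

text \<open>The competing presentations may be taken with summands indexed by natural numbers, because
  all index sets are finite.\<close>

definition minimal_projective_presentation :: "'p::order set \<Rightarrow> ('p, 'b) pmodule \<Rightarrow>
    'j set \<Rightarrow> ('j \<Rightarrow> 'p) \<Rightarrow> 'i set \<Rightarrow> ('i \<Rightarrow> 'p) \<Rightarrow>
    ('p \<Rightarrow> ('i \<Rightarrow>\<^sub>0 bit) \<Rightarrow> ('j \<Rightarrow>\<^sub>0 bit)) \<Rightarrow> bool" where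
  "minimal_projective_presentation P M J h I g q1 \<longleftrightarrow>
     projective_presentation P M J h I g q1 \<and>
     (\<forall>(J' :: nat set) h' (I' :: nat set) g' q1'.
        projective_presentation P M J' h' I' g' q1' \<longrightarrow> card J \<le> card J' \<and> card I \<le> card I')"

section \<open>Graded matrices\<close>

text \<open>Only the grades of elements of \<open>rows\<close> and \<open>cols\<close>, and the entries with indices in
  these sets, are relevant.\<close>

record ('j, 'i, 'p) gmatrix =
  rows :: "'j set"
  cols :: "'i set"
  row_grade :: "'j \<Rightarrow> 'p"
  col_grade :: "'i \<Rightarrow> 'p"
  entry :: "'j \<Rightarrow> 'i \<Rightarrow> bit"

definition graded_matrix :: "'p::order set \<Rightarrow> ('j, 'i, 'p) gmatrix \<Rightarrow> bool" where
  "graded_matrix P A \<longleftrightarrow>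
     finite (rows A) \<and> finite (cols A) \<and>
     row_grade A ` rows A \<subseteq> P \<and> col_grade A ` cols A \<subseteq> P \<and>
     (\<forall>j\<in>rows A. \<forall>i\<in>cols A. entry A j i \<noteq> 0 \<longrightarrow> row_grade A j \<le> col_grade A i)"

definition matrix_morphism ::
    "('j, 'i, 'p) gmatrix \<Rightarrow> 'p \<Rightarrow> ('i \<Rightarrow>\<^sub>0 bit) \<Rightarrow> ('j \<Rightarrow>\<^sub>0 bit)" where
  "matrix_morphism A x =
     linear_extension (\<lambda>i. \<Sum>j\<in>rows A. scale (entry A j i) (basis_vec j))"

lemma pmodule_morphism_matrix_morphism:
  assumes "graded_matrix P A"
  shows "pmodule_morphism P (proj_sum (cols A) (col_grade A)) (proj_sum (rows A) (row_grade A))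
    (matrix_morphism A)"
proof -
  have "scale (entry A j i) (basis_vec j) \<in> free_on {j \<in> rows A. row_grade A j \<le> x}"
    if "i \<in> cols A" "col_grade A i \<le> x" "j \<in> rows A" for i j x
  proof (cases "entry A j i = 0")
    case True
    then show ?thesis by (simp add: F2.subspace_0 subspace_free_on)
  next
    case False
    then have "row_grade A j \<le> x"
      using assms that by (meson graded_matrix_def order_trans)
    then show ?thesis
      using that by (intro F2.subspace_scale subspace_free_on basis_vec_in_free_on) auto
  qed
  then have "linear_between (free_on {i \<in> cols A. col_grade A i \<le> x})
      (free_on {j \<in> rows A. row_grade A j \<le> x}) (matrix_morphism A x)" for x
    unfolding matrix_morphism_def
    by (intro linear_between_linear_extension F2.subspace_sum subspace_free_on) auto
  moreover have "finite (rows A)" "finite (cols A)"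
    using assms by (auto simp: graded_matrix_def)
  ultimately show ?thesis
    by (auto simp: pmodule_morphism_def persistence_module_proj_sum)
      (auto simp: proj_sum_def matrix_morphism_def)
qed

definition minimal_presentation_matrix ::
    "'p::order set \<Rightarrow> ('p, 'b) pmodule \<Rightarrow> ('j, 'i, 'p) gmatrix \<Rightarrow> bool" where
  "minimal_presentation_matrix P M A \<longleftrightarrow>
     graded_matrix P A \<and>
     minimal_projective_presentation P M (rows A) (row_grade A) (cols A) (col_grade A)
       (matrix_morphism A)"

definition delete_row :: "'j \<Rightarrow> ('j, 'i, 'p) gmatrix \<Rightarrow> ('j, 'i, 'p) gmatrix" where
  "delete_row j A = A\<lparr>rows := rows A - {j}\<rparr>"

section \<open>Filtered graphs\<close>

text \<open>The poset \<open>P\<close> with a new least element \<open>None\<close> (that is, \<open>-\<infinity>\<close>), ordered as in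
  \<open>Option_ord\<close>.\<close>

definition with_bot :: "'p set \<Rightarrow> 'p option set" where
  "with_bot P = insert None (Some ` P)"

text \<open>For a matrix all of whose labels are of the form \<open>Some x\<close>.\<close>

definition unlift_grades :: "('j, 'i, 'p option) gmatrix \<Rightarrow> ('j, 'i, 'p) gmatrix" where
  "unlift_grades A =
     \<lparr>rows = rows A, cols = cols A,
      row_grade = the \<circ> row_grade A, col_grade = the \<circ> col_grade A,
      entry = entry A\<rparr>"

text \<open>A Delta-complex of dimension at most one: the two face maps send an edge to its endpoints.
  Multiple edges are allowed, and so are loops.\<close>

record ('a, 'e) graph =
  verts :: "'a set"
  edges :: "'e set"
  face0 :: "'e \<Rightarrow> 'a"
  face1 :: "'e \<Rightarrow> 'a"

definition delta_graph :: "('a, 'e) graph \<Rightarrow> bool" where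
  "delta_graph \<Gamma> \<longleftrightarrow>
     finite (verts \<Gamma>) \<and> finite (edges \<Gamma>) \<and>
     face0 \<Gamma> ` edges \<Gamma> \<subseteq> verts \<Gamma> \<and> face1 \<Gamma> ` edges \<Gamma> \<subseteq> verts \<Gamma>"

definition subgraph :: "('a, 'e) graph \<Rightarrow> ('a, 'e) graph \<Rightarrow> bool" where
  "subgraph \<Gamma> \<Delta> \<longleftrightarrow>
     verts \<Gamma> \<subseteq> verts \<Delta> \<and> edges \<Gamma> \<subseteq> edges \<Delta> \<and>
     (\<forall>e\<in>edges \<Gamma>. face0 \<Gamma> e = face0 \<Delta> e \<and> face1 \<Gamma> e = face1 \<Delta> e)"

text \<open>A functor to graphs all of whose maps are inclusions is determined by its values on
  objects.\<close>

definition filtered_graph :: "'q::order set \<Rightarrow> ('q \<Rightarrow> ('a, 'e) graph) \<Rightarrow> bool" where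
  "filtered_graph Q G \<longleftrightarrow>
     (\<forall>x\<in>Q. delta_graph (G x)) \<and> (\<forall>x\<in>Q. \<forall>y\<in>Q. x \<le> y \<longrightarrow> subgraph (G x) (G y))"

definition all_verts :: "'q set \<Rightarrow> ('q \<Rightarrow> ('a, 'e) graph) \<Rightarrow> 'a set" where
  "all_verts Q G = (\<Union>x\<in>Q. verts (G x))"

definition all_edges :: "'q set \<Rightarrow> ('q \<Rightarrow> ('a, 'e) graph) \<Rightarrow> 'e set" where
  "all_edges Q G = (\<Union>x\<in>Q. edges (G x))"

definition vertex_born :: "'q::order set \<Rightarrow> ('q \<Rightarrow> ('a, 'e) graph) \<Rightarrow> 'a \<Rightarrow> 'q \<Rightarrow> bool" where
  "vertex_born Q G v x \<longleftrightarrow> x \<in> Q \<and> (\<forall>y\<in>Q. v \<in> verts (G y) \<longleftrightarrow> x \<le> y)"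

definition edge_born :: "'q::order set \<Rightarrow> ('q \<Rightarrow> ('a, 'e) graph) \<Rightarrow> 'e \<Rightarrow> 'q \<Rightarrow> bool" where
  "edge_born Q G e x \<longleftrightarrow> x \<in> Q \<and> (\<forall>y\<in>Q. e \<in> edges (G y) \<longleftrightarrow> x \<le> y)"

definition vertex_grade :: "'q::order set \<Rightarrow> ('q \<Rightarrow> ('a, 'e) graph) \<Rightarrow> 'a \<Rightarrow> 'q" where
  "vertex_grade Q G v = (THE x. vertex_born Q G v x)"

definition edge_grade :: "'q::order set \<Rightarrow> ('q \<Rightarrow> ('a, 'e) graph) \<Rightarrow> 'e \<Rightarrow> 'q" where
  "edge_grade Q G e = (THE x. edge_born Q G e x)"

text \<open>The entry is the coefficient of the vertex in the boundary of the edge, so the column of a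
  loop is zero. The endpoints of an edge are read off at its birth grade.\<close>

definition boundary_matrix ::
    "'q::order set \<Rightarrow> ('q \<Rightarrow> ('a, 'e) graph) \<Rightarrow> ('a, 'e, 'q) gmatrix" where
  "boundary_matrix Q G =
     \<lparr>rows = all_verts Q G, cols = all_edges Q G,
      row_grade = vertex_grade Q G, col_grade = edge_grade Q G,
      entry = (\<lambda>v e. let \<Gamma> = G (edge_grade Q G e)
                      in of_bool (v = face0 \<Gamma> e) + of_bool (v = face1 \<Gamma> e))\<rparr>"

end

theory Submission
  imports Defs
begin

text \<open>A simplex, or \<open>0\<close> when it degenerates, is sent to a simplex or \<open>0\<close>, so
  \<open>C\<^sub>l(K)\<close> is the linearization of a functor to pointed sets. The simplices that are not
  images from a lower grade generate it minimally, and the kernel of the resulting cover is spanned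
  at each grade by differences of generators with the same image, where \<open>0\<close> plays the role of
  \<open>\<Omega>\<close>. Choosing, grade by grade, differences that extend a basis of the span of the older
  ones to a basis of the kernel gives the edges.

  For minimality, a competing cover \<open>Q\<^sub>0' \<rightarrow> M\<close> lifts to a map \<open>Q\<^sub>0' \<rightarrow> Q\<^sub>0\<close>, which is
  onto by Nakayama's lemma and therefore maps the kernel of \<open>Q\<^sub>0' \<rightarrow> M\<close> onto that of
  \<open>Q\<^sub>0 \<rightarrow> M\<close>. Generators of the former thus give generators of the latter, and these can be
  counted grade by grade modulo the image of the lower grades.\<close>

section \<open>Linear algebra over the field with two elements\<close>

lemma diff_eq_add_bit: "u - v = (u + v :: 'b \<Rightarrow>\<^sub>0 bit)"
  by (rule poly_mapping_eqI) (simp add: lookup_add lookup_minus)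

lemma free_on_eq_span: "free_on B = F2.span (basis_vec ` B)"
proof
  show "F2.span (basis_vec ` B) \<subseteq> free_on B"
    by (rule F2.span_minimal) (auto simp: subspace_free_on basis_vec_in_free_on)
  show "free_on B \<subseteq> F2.span (basis_vec ` B)"
  proof
    fix v assume v: "v \<in> free_on B"
    have "(\<Sum>b\<in>Poly_Mapping.keys v. scale (Poly_Mapping.lookup v b) (basis_vec b))
        \<in> F2.span (basis_vec ` B)"
      by (intro F2.span_sum F2.span_scale F2.span_base) (use v in \<open>auto simp: free_on_def\<close>)
    then show "v \<in> F2.span (basis_vec ` B)"
      using basis_vec_decomposition[of v] by simp
  qed
qed

lemma inj_basis_vec: "inj basis_vec"
proof (rule injI)
  fix a b :: 'b assume "basis_vec a = basis_vec b"
  then have "Poly_Mapping.keys (basis_vec a) = Poly_Mapping.keys (basis_vec b)" by simp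
  then show "a = b" by (simp add: basis_vec_def)
qed

lemma independent_basis_vec: "F2.independent (basis_vec ` B)"
  unfolding F2.dependent_def
proof (safe)
  fix b assume b: "basis_vec b \<in> F2.span (basis_vec ` B - {basis_vec b})"
  have "basis_vec ` B - {basis_vec b} = basis_vec ` (B - {b})"
    using inj_basis_vec by (auto simp: inj_def)
  then have "basis_vec b \<in> free_on (B - {b})" using b by (simp add: free_on_eq_span)
  then show False by (simp add: free_on_def basis_vec_def)
qed

lemma linear_extension_zero [simp]: "linear_extension \<phi> 0 = 0"
  by (simp add: linear_extension_def)

lemma lookup_linear_extension:
  "Poly_Mapping.lookup (linear_extension \<phi> v) c =
    (\<Sum>b\<in>Poly_Mapping.keys v. Poly_Mapping.lookup v b * Poly_Mapping.lookup (\<phi> b) c)"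
  by (simp add: linear_extension_def lookup_sum lookup_scale)

lemma linear_between_linear_extension_UNIV:
  "linear_between V UNIV (linear_extension \<phi>)"
  by (simp add: linear_between_def linear_extension_add linear_extension_scale)

lemma subspace_linear_vimage:
  assumes "linear_between V W f" "F2.subspace V" "F2.subspace U"
  shows "F2.subspace {v \<in> V. f v \<in> U}"
proof -
  have "f 0 = 0"
  proof -
    have "f (scale 0 0) = scale 0 (f 0)"
      using assms F2.subspace_0 unfolding linear_between_def by blast
    then show ?thesis by simp
  qed
  then show ?thesis
    using assms unfolding linear_between_def F2.subspace_def by auto
qed

text \<open>A linear map is controlled by its values on a basis. With \<open>U = {0}\<close> and a
  difference of two maps in place of \<open>f\<close>, this proves that the maps agree.\<close>

lemma linear_image_free_on_subset:
  assumes "linear_between (free_on A) W f" "F2.subspace U" "\<And>a. a \<in> A \<Longrightarrow> f (basis_vec a) \<in> U"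
  shows "f ` free_on A \<subseteq> U"
proof -
  have "F2.span (basis_vec ` A) \<subseteq> {v \<in> free_on A. f v \<in> U}"
    by (rule F2.span_minimal)
      (use assms in \<open>auto simp: basis_vec_in_free_on
        intro!: subspace_linear_vimage subspace_free_on\<close>)
  then show ?thesis by (auto simp: free_on_eq_span)
qed

lemma linear_extension_image_free_on:
  "linear_extension \<phi> ` free_on A = F2.span (\<phi> ` A)"
proof
  show "linear_extension \<phi> ` free_on A \<subseteq> F2.span (\<phi> ` A)"
    by (rule linear_image_free_on_subset[OF linear_between_linear_extension_UNIV])
      (auto simp: linear_extension_basis_vec intro: F2.span_base)
  have "F2.subspace (linear_extension \<phi> ` free_on A)"
    using subspace_free_on[of A] unfolding F2.subspace_def
    by (auto simp flip: linear_extension_add linear_extension_scale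
        intro: image_eqI[where x = 0])
  moreover have "\<phi> ` A \<subseteq> linear_extension \<phi> ` free_on A"
    by (auto intro!: image_eqI[of _ _ "basis_vec _"]
        simp: linear_extension_basis_vec basis_vec_in_free_on)
  ultimately show "F2.span (\<phi> ` A) \<subseteq> linear_extension \<phi> ` free_on A"
    by (intro F2.span_minimal)
qed

text \<open>Indices of grade below \<open>x\<close> contribute only to the span of \<open>S\<close>,
  so \<open>S\<close> and the images of the indices of grade exactly \<open>x\<close> together span
  the independent set \<open>S \<union> B\<close>; the exchange lemma then bounds
  \<open>card B\<close>. The count is applied once to generators and once to relations.\<close>

lemma card_new_generators_le:
  fixes g :: "'i \<Rightarrow> 'p::order"
  assumes "finite I" and lin: "linear_between (free_on {i \<in> I. g i \<le> x}) W f"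
    and gen: "S \<union> B \<subseteq> f ` free_on {i \<in> I. g i \<le> x}"
    and old: "\<And>i. i \<in> I \<Longrightarrow> g i < x \<Longrightarrow> f (basis_vec i) \<in> F2.span S"
    and S: "finite S" "S \<inter> B = {}" "F2.independent (S \<union> B)"
  shows "card B \<le> card {i \<in> I. g i = x}"
proof -
  let ?C = "(\<lambda>i. f (basis_vec i)) ` {i \<in> I. g i = x}"
  have "f ` free_on {i \<in> I. g i \<le> x} \<subseteq> F2.span (S \<union> ?C)"
  proof (rule linear_image_free_on_subset[OF lin F2.subspace_span])
    fix i assume i: "i \<in> {i \<in> I. g i \<le> x}"
    show "f (basis_vec i) \<in> F2.span (S \<union> ?C)"
    proof (cases "g i = x")
      case True
      then show ?thesis using i by (auto intro: F2.span_base)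
    next
      case False
      then have "f (basis_vec i) \<in> F2.span S" using i old by auto
      then show ?thesis using F2.span_mono[of S "S \<union> ?C"] by auto
    qed
  qed
  with gen have "S \<union> B \<subseteq> F2.span (S \<union> ?C)" by blast
  then have "finite (S \<union> B) \<and> card (S \<union> B) \<le> card (S \<union> ?C)"
    using \<open>finite I\<close> S by (intro F2.independent_span_bound) auto
  moreover have "card (S \<union> ?C) \<le> card S + card ?C" by (rule card_Un_le)
  moreover have "card ?C \<le> card {i \<in> I. g i = x}"
    using \<open>finite I\<close> by (intro card_image_le) auto
  ultimately show ?thesis using S by (auto simp: card_Un_disjoint)
qed

section \<open>Counting by grade and induction along a finite poset\<close>

lemma card_le_by_fibres:
  assumes "finite P" "finite A" "finite B" "f ` A \<subseteq> P" "g ` B \<subseteq> P"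
    and "\<And>x. x \<in> P \<Longrightarrow> card {a \<in> A. f a = x} \<le> card {b \<in> B. g b = x}"
  shows "card A \<le> card B"
proof -
  have "card A = (\<Sum>x\<in>P. card {a \<in> A. f a = x})"
    using sum.group[of A P f "\<lambda>_. 1::nat"] assms by simp
  also have "\<dots> \<le> (\<Sum>x\<in>P. card {b \<in> B. g b = x})"
    by (rule sum_mono) (rule assms)
  also have "\<dots> = card B"
    using sum.group[of B P g "\<lambda>_. 1::nat"] assms by simp
  finally show ?thesis .
qed

text \<open>The number of elements of \<open>P\<close> strictly below \<open>x\<close> serves as a
  measure: it drops from \<open>x\<close> to \<open>y < x\<close> because \<open>y\<close> is not
  strictly below itself.\<close>

lemma finite_poset_induct [consumes 2, case_names less]:
  fixes x :: "'p::order"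
  assumes "finite P" "x \<in> P"
    and step: "\<And>x. x \<in> P \<Longrightarrow> (\<And>y. y \<in> P \<Longrightarrow> y < x \<Longrightarrow> Q y) \<Longrightarrow> Q x"
  shows "Q x"
  using \<open>x \<in> P\<close>
proof (induction "card {y \<in> P. y < x}" arbitrary: x rule: less_induct)
  case less
  show ?case
  proof (rule step[OF less.prems])
    fix y assume y: "y \<in> P" "y < x"
    then have "{z \<in> P. z < y} \<subset> {y \<in> P. y < x}" by auto
    then have "card {z \<in> P. z < y} < card {y \<in> P. y < x}"
      using \<open>finite P\<close> by (intro psubset_card_mono) auto
    then show "Q y" using y less.hyps by blast
  qed
qed

lemma bchoice2:
  assumes "\<And>x. x \<in> A \<Longrightarrow> \<exists>a b. R x a b"
  shows "\<exists>f g. \<forall>x\<in>A. R x (f x) (g x)"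
  using assms by metis

section \<open>Modules of pointed sets\<close>

text \<open>\<open>X\<close>, with \<open>0\<close> as base point, is a functor to finite pointed sets, and \<open>M\<close> is its
  reduced linearization.\<close>

locale monomial_module =
  fixes P :: "'p::order set" and M :: "('p, 'b) pmodule" and X :: "'p \<Rightarrow> 'b set"
    and \<tau> :: "'p \<Rightarrow> 'p \<Rightarrow> 'b \<Rightarrow> ('b \<Rightarrow>\<^sub>0 bit)"
  assumes finite_P: "finite P"
    and module: "persistence_module P M"
    and space: "space_at M x = free_on (X x)"
    and trans: "trans_map M x y = linear_extension (\<tau> x y)"
    and finite_X: "x \<in> P \<Longrightarrow> finite (X x)"
    and monomial: "x \<in> P \<Longrightarrow> y \<in> P \<Longrightarrow> x \<le> y \<Longrightarrow> c \<in> X x \<Longrightarrow>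
      \<tau> x y c \<in> insert 0 (basis_vec ` X y)"
begin

text \<open>Transition maps send basis elements to basis elements or \<open>0\<close>, so these
  elements span the images in \<open>M\<close> of all strictly lower grades, that is, the radical at
  \<open>x\<close>. The remaining elements of \<open>X x\<close> are the generators of a minimal
  cover.\<close>

definition decomposable :: "'p \<Rightarrow> 'b set" where
  "decomposable x = {c \<in> X x. \<exists>y\<in>P. y < x \<and> basis_vec c \<in> \<tau> y x ` X y}"

end

text \<open>Generators are numbered by \<open>J\<close>: number \<open>j\<close> stands for the
  element \<open>s j\<close> born at grade \<open>h j\<close>. The number \<open>0\<close> stays
  free to name the extra vertex of the graph.\<close>

locale generated_module = monomial_module P M X \<tau>
  for P :: "'p::order set" and M :: "('p, 'b) pmodule" and X \<tau> +
  fixes J :: "nat set" and h :: "nat \<Rightarrow> 'p" and s :: "nat \<Rightarrow> 'b"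
  assumes finite_J: "finite J" and zero_notin_J: "0 \<notin> J" and h_in: "j \<in> J \<Longrightarrow> h j \<in> P"
    and bij_generators: "bij_betw (\<lambda>j. (h j, s j)) J (SIGMA x:P. X x - decomposable x)"
begin

abbreviation below :: "'p \<Rightarrow> nat set" where
  "below x \<equiv> {j \<in> J. h j \<le> x}"

definition cover :: "'p \<Rightarrow> (nat \<Rightarrow>\<^sub>0 bit) \<Rightarrow> ('b \<Rightarrow>\<^sub>0 bit)" where
  "cover x = linear_extension (\<lambda>j. \<tau> (h j) x (s j))"

text \<open>The vertex \<open>0\<close> is the distinguished one, whose row gets deleted.\<close>

definition vertex_vec :: "nat \<Rightarrow> (nat \<Rightarrow>\<^sub>0 bit)" where
  "vertex_vec a = (if a = 0 then 0 else basis_vec a)"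

definition vertices :: "'p \<Rightarrow> nat set" where
  "vertices x = insert 0 (below x)"

text \<open>These are the candidate edge boundaries at grade \<open>x\<close>. Taking
  \<open>b = 0\<close> yields the generators that have died by \<open>x\<close>; taking
  \<open>a = b\<close> yields only the zero vector.\<close>

definition edge_vecs :: "'p \<Rightarrow> (nat \<Rightarrow>\<^sub>0 bit) set" where
  "edge_vecs x = {vertex_vec a + vertex_vec b | a b.
     a \<in> vertices x \<and> b \<in> vertices x \<and> cover x (vertex_vec a) = cover x (vertex_vec b)}"

section \<open>The cover, its surjectivity and its kernel\<close>

lemma cover_linear: "linear_between V UNIV (cover x)"
  unfolding cover_def by (rule linear_between_linear_extension_UNIV)

lemma cover_0 [simp]: "cover x 0 = 0"
  by (simp add: cover_def)

lemma cover_add: "cover x (u + v) = cover x u + cover x v"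
  by (simp add: cover_def linear_extension_add)

lemma cover_scale: "cover x (scale a v) = scale a (cover x v)"
  by (simp add: cover_def linear_extension_scale)

lemma cover_basis_vec: "cover x (basis_vec j) = \<tau> (h j) x (s j)"
  by (simp add: cover_def linear_extension_basis_vec)

lemma generator:
  assumes "j \<in> J"
  shows "s j \<in> X (h j)" "s j \<notin> decomposable (h j)"
  using bij_betw_apply[OF bij_generators assms] by auto

lemma generator_exists:
  assumes "x \<in> P" "c \<in> X x" "c \<notin> decomposable x"
  shows "\<exists>j\<in>J. h j = x \<and> s j = c"
proof -
  have "(x, c) \<in> (\<lambda>j. (h j, s j)) ` J"
    using bij_betw_imp_surj_on[OF bij_generators] assms by auto
  then show ?thesis by auto
qed

lemma generator_unique:
  assumes "i \<in> J" "j \<in> J" "h i = h j" "s i = s j"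
  shows "i = j"
  using inj_onD[OF bij_betw_imp_inj_on[OF bij_generators]] assms by simp

text \<open>The functor laws are assumed for the transition maps of \<open>M\<close> only;
  evaluation at basis vectors transfers them to \<tau>, here and in
  \<open>tau_compose\<close>.\<close>

lemma tau_refl:
  assumes "x \<in> P" "c \<in> X x"
  shows "\<tau> x x c = basis_vec c"
proof -
  have "trans_map M x x (basis_vec c) = basis_vec c"
    using module assms unfolding persistence_module_def space
    by (simp add: basis_vec_in_free_on)
  then show ?thesis by (simp add: trans linear_extension_basis_vec)
qed

lemma tau_compose:
  assumes "x \<in> P" "y \<in> P" "z \<in> P" "x \<le> y" "y \<le> z" "c \<in> X x"
  shows "linear_extension (\<tau> y z) (\<tau> x y c) = \<tau> x z c"
proof -
  have "trans_map M y z (trans_map M x y (basis_vec c)) = trans_map M x z (basis_vec c)"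
    using module assms unfolding persistence_module_def space
    by (simp add: basis_vec_in_free_on)
  then show ?thesis by (simp add: trans linear_extension_basis_vec)
qed

text \<open>Transition maps of \<open>proj_sum\<close> are inclusions, so naturality compares the
  values of two covers at the same vector. On a generator it is functoriality along
  \<open>h j \<le> x \<le> y\<close>.\<close>

lemma cover_natural:
  assumes "x \<in> P" "y \<in> P" "x \<le> y" "v \<in> free_on (below x)"
  shows "linear_extension (\<tau> x y) (cover x v) = cover y v"
  unfolding cover_def
  by (rule linear_extension_compose[OF assms(4)])
    (use assms generator h_in in \<open>auto intro!: tau_compose\<close>)

lemma cover_basis_vec_monomial:
  assumes "x \<in> P" "j \<in> below x"
  shows "cover x (basis_vec j) \<in> insert 0 (basis_vec ` X x)"
  using assms generator h_in unfolding cover_basis_vec by (intro monomial) auto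

lemma vertex_vec_in_free_on: "a \<in> vertices x \<Longrightarrow> vertex_vec a \<in> free_on (below x)"
  by (auto simp: vertex_vec_def vertices_def F2.subspace_0[OF subspace_free_on]
      intro: basis_vec_in_free_on)

lemma vertices_mono: "x \<le> y \<Longrightarrow> vertices x \<subseteq> vertices y"
  by (auto simp: vertices_def)

lemma finite_vertices: "finite (vertices x)"
  using finite_J by (simp add: vertices_def)

text \<open>Two generators that have merged stay merged, and a dead one stays dead, by naturality of
  the cover.\<close>

lemma edge_vecs_mono:
  assumes "x \<in> P" "y \<in> P" "x \<le> y"
  shows "edge_vecs x \<subseteq> edge_vecs y"
proof
  fix v assume "v \<in> edge_vecs x"
  then obtain a b where ab: "v = vertex_vec a + vertex_vec b" "a \<in> vertices x" "b \<in> vertices x"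
    "cover x (vertex_vec a) = cover x (vertex_vec b)"
    by (auto simp: edge_vecs_def)
  then have "cover y (vertex_vec a) = cover y (vertex_vec b)"
    using cover_natural[OF assms vertex_vec_in_free_on] by metis
  then show "v \<in> edge_vecs y"
    using ab vertices_mono[OF assms(3)] by (auto simp: edge_vecs_def)
qed

lemma finite_edge_vecs: "finite (edge_vecs x)"
proof -
  have "edge_vecs x \<subseteq> (\<lambda>(a, b). vertex_vec a + vertex_vec b) ` (vertices x \<times> vertices x)"
    by (auto simp: edge_vecs_def)
  then show ?thesis using finite_vertices by (meson finite_SigmaI finite_imageI finite_subset)
qed

text \<open>A decomposable element is the image of an element of lower grade, whose generator serves
  again; any other element is itself a generator. That one generator suffices, without linear
  combinations, is what later makes the kernel spanned by edges.\<close>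

lemma basis_vec_covered:
  assumes "x \<in> P" "c \<in> X x"
  shows "\<exists>j\<in>below x. cover x (basis_vec j) = basis_vec c"
  using finite_P assms
proof (induction x arbitrary: c rule: finite_poset_induct)
  case (less x)
  show ?case
  proof (cases "c \<in> decomposable x")
    case True
    then obtain y d where y: "y \<in> P" "y < x" "d \<in> X y" "basis_vec c = \<tau> y x d"
      by (auto simp: decomposable_def)
    then obtain j where j: "j \<in> below y" "cover y (basis_vec j) = basis_vec d"
      using less.IH by blast
    have "cover x (basis_vec j) = linear_extension (\<tau> y x) (basis_vec d)"
      using cover_natural[of y x "basis_vec j"] j y less.hyps
      by (simp add: basis_vec_in_free_on)
    then show ?thesis using j y by (force simp: linear_extension_basis_vec)
  next
    case False
    then obtain j where "j \<in> J" "h j = x" "s j = c"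
      using generator_exists less by blast
    then show ?thesis using less by (auto simp: cover_basis_vec tau_refl)
  qed
qed

lemma cover_surj:
  assumes "x \<in> P"
  shows "cover x ` free_on (below x) = free_on (X x)"
proof
  show "cover x ` free_on (below x) \<subseteq> free_on (X x)"
    by (rule linear_image_free_on_subset[OF cover_linear subspace_free_on])
      (use cover_basis_vec_monomial[OF assms] F2.subspace_0[OF subspace_free_on]
        in \<open>force intro: basis_vec_in_free_on\<close>)
  have "basis_vec ` X x \<subseteq> (\<lambda>j. \<tau> (h j) x (s j)) ` below x"
    using basis_vec_covered[OF assms] unfolding cover_basis_vec by force
  then show "free_on (X x) \<subseteq> cover x ` free_on (below x)"
    unfolding cover_def linear_extension_image_free_on free_on_eq_span[of "X x"]
    by (rule F2.span_mono)
qed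

text \<open>Every element is congruent, modulo edges, to its image under a pointed section of the
  cover, and the section kills the kernel.\<close>

lemma kernel_eq_span_edge_vecs:
  assumes x: "x \<in> P"
  shows "{v \<in> free_on (below x). cover x v = 0} = F2.span (edge_vecs x)"
proof
  have sub: "F2.subspace {v \<in> free_on (below x). cover x v \<in> {0}}"
    by (rule subspace_linear_vimage[OF cover_linear subspace_free_on F2.subspace_single_0])
  have "edge_vecs x \<subseteq> {v \<in> free_on (below x). cover x v \<in> {0}}"
  proof
    fix v assume "v \<in> edge_vecs x"
    then obtain a b where ab: "v = vertex_vec a + vertex_vec b" "a \<in> vertices x"
      "b \<in> vertices x" "cover x (vertex_vec a) = cover x (vertex_vec b)"
      by (auto simp: edge_vecs_def)
    \<comment> \<open>In characteristic two the sum of two equal images is their difference, hence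
      zero.\<close>
    then have "cover x v = cover x (vertex_vec a) - cover x (vertex_vec a)"
      by (simp only: cover_add diff_eq_add_bit)
    then show "v \<in> {v \<in> free_on (below x). cover x v \<in> {0}}"
      using ab by (auto intro!: F2.subspace_add subspace_free_on vertex_vec_in_free_on)
  qed
  from F2.span_minimal[OF this sub]
  show "F2.span (edge_vecs x) \<subseteq> {v \<in> free_on (below x). cover x v = 0}" by auto
next
  \<comment> \<open>The section sends basis vectors to basis vectors, since each basis element is
    hit by a single generator.\<close>
  obtain r where r: "\<And>c. c \<in> X x \<Longrightarrow> r c \<in> below x \<and> cover x (basis_vec (r c)) = basis_vec c"
    using basis_vec_covered[OF x] by metis
  let ?\<rho> = "linear_extension (\<lambda>c. basis_vec (r c))"
  have "free_on (below x) \<subseteq> {v. v + ?\<rho> (cover x v) \<in> F2.span (edge_vecs x)}" (is "_ \<subseteq> ?R")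
    unfolding free_on_eq_span
  proof (rule F2.span_minimal)
    show "basis_vec ` below x \<subseteq> ?R"
    proof safe
      fix j assume j: "j \<in> J" "h j \<le> x"
      then have j': "j \<in> vertices x" "vertex_vec j = basis_vec j"
        using zero_notin_J by (auto simp: vertices_def vertex_vec_def)
      \<comment> \<open>The vertex \<open>a\<close> is the one to which \<open>j\<close> gets
        joined: the chosen generator with the same image or, if \<open>j\<close> has died by grade
        \<open>x\<close>, the distinguished vertex \<open>0\<close>.\<close>
      obtain a where a: "a \<in> vertices x" "vertex_vec a = ?\<rho> (cover x (basis_vec j))"
        "cover x (vertex_vec a) = cover x (basis_vec j)"
      proof (cases "cover x (basis_vec j) = 0")
        case True
        then show thesis using that[of 0] by (simp add: vertices_def vertex_vec_def)
      next
        case False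
        then obtain c where c: "c \<in> X x" "cover x (basis_vec j) = basis_vec c"
          using cover_basis_vec_monomial[OF x, of j] j by auto
        then have "vertex_vec (r c) = basis_vec (r c)"
          using r[OF c(1)] zero_notin_J by (metis (lifting) mem_Collect_eq vertex_vec_def)
        then show thesis
          using that[of "r c"] c r by (simp add: linear_extension_basis_vec vertices_def)
      qed
      have "vertex_vec j + vertex_vec a \<in> edge_vecs x"
        using a j' unfolding edge_vecs_def by fastforce
      then show "basis_vec j + ?\<rho> (cover x (basis_vec j)) \<in> F2.span (edge_vecs x)"
        using a j' by (simp add: F2.span_base)
    qed
    show "F2.subspace ?R"
    proof (rule F2.subspaceI)
      show "0 \<in> ?R" by (simp add: F2.span_zero)
    next
      fix u v assume "u \<in> ?R" "v \<in> ?R"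
      then show "u + v \<in> ?R"
        using F2.span_add[of "u + ?\<rho> (cover x u)" _ "v + ?\<rho> (cover x v)"]
        by (simp add: cover_add linear_extension_add algebra_simps)
    next
      fix a v assume "v \<in> ?R"
      then show "scale a v \<in> ?R"
        using F2.span_scale[of "v + ?\<rho> (cover x v)" _ a]
        by (simp add: cover_scale linear_extension_scale F2.scale_right_distrib)
    qed
  qed
  then show "{v \<in> free_on (below x). cover x v = 0} \<subseteq> F2.span (edge_vecs x)"
    by (auto dest!: subsetD)
qed

text \<open>At grade \<open>h j\<close> only the generator \<open>j\<close> contributes to the
  coefficient of \<open>s j\<close>: another generator of the same grade is a different basis
  element, and an older one mapping to \<open>s j\<close> would make it decomposable.\<close>

lemma lookup_cover:
  assumes "j \<in> J" "v \<in> free_on (below (h j))"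
  shows "Poly_Mapping.lookup (cover (h j) v) (s j) = Poly_Mapping.lookup v j"
proof -
  have x: "h j \<in> P" using assms h_in by auto
  have delta: "Poly_Mapping.lookup (\<tau> (h k) (h j) (s k)) (s j) = of_bool (k = j)"
    if k: "k \<in> below (h j)" for k
  proof (cases "h k = h j")
    case True
    then show ?thesis
      using k assms x generator[of k] generator_unique[of k j]
      by (auto simp: tau_refl basis_vec_def lookup_single when_def)
  next
    case False
    have "\<tau> (h k) (h j) (s k) \<in> insert 0 (basis_vec ` X (h j))"
      using cover_basis_vec_monomial[OF x k] by (simp add: cover_basis_vec)
    moreover have "\<tau> (h k) (h j) (s k) \<noteq> basis_vec (s j)"
      using False k generator[OF assms(1)] generator[of k] h_in[of k]
      by (force simp: decomposable_def)
    ultimately show ?thesis using False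
      by (auto simp: basis_vec_def lookup_single when_def)
  qed
  have keys: "Poly_Mapping.keys v \<subseteq> below (h j)" using assms by (simp add: free_on_def)
  have "Poly_Mapping.lookup (cover (h j) v) (s j) =
      (\<Sum>k\<in>Poly_Mapping.keys v. if k = j then Poly_Mapping.lookup v j else 0)"
    unfolding cover_def lookup_linear_extension
    by (rule sum.cong) (use keys delta in auto)
  also have "\<dots> = Poly_Mapping.lookup v j"
    by (subst sum.delta) (auto simp: in_keys_iff)
  finally show ?thesis .
qed

text \<open>By \<open>lookup_cover\<close>, a generator born at \<open>x\<close> keeps its
  coefficient under the cover, so it cannot occur in a kernel vector. This is the minimality of the
  cover, and the input to Nakayama's lemma.\<close>

lemma kernel_in_radical:
  assumes "x \<in> P" "v \<in> free_on (below x)" "cover x v = 0"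
  shows "v \<in> free_on {j \<in> J. h j < x}"
proof -
  have "h j \<noteq> x" if "j \<in> Poly_Mapping.keys v" for j
  proof
    assume "h j = x"
    moreover have "j \<in> J" using assms that by (auto simp: free_on_def)
    ultimately have "Poly_Mapping.lookup v j = 0"
      using lookup_cover[of j v] assms by simp
    then show False using that by (simp add: in_keys_iff)
  qed
  then show ?thesis using assms by (force simp: free_on_def)
qed

lemma cover_morphism: "pmodule_morphism P (proj_sum J h) M cover"
proof -
  have "linear_between (free_on (below x)) (free_on (X x)) (cover x)" if "x \<in> P" for x
    using cover_surj[OF that] cover_linear[of "free_on (below x)" x]
    unfolding linear_between_def by auto
  then show ?thesis
    using persistence_module_proj_sum[OF finite_J, of P h] module
    unfolding pmodule_morphism_def
    by (auto simp: proj_sum_def space trans cover_natural)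
qed

text \<open>At each grade, \<open>old x\<close> is a basis, consisting of edge vectors, of the span
  of all relations inherited from strictly lower grades. Since these persist, it can be completed
  inside \<open>edge_vecs x\<close>, so the relations added in \<open>new x\<close> are again edges,
  and their number is the dimension of the kernel modulo what comes from below.\<close>

lemma relation_bases_exist:
  "\<exists>old new. \<forall>x\<in>P.
     old x \<subseteq> (\<Union>y\<in>{y \<in> P. y < x}. edge_vecs y) \<and>
     (\<Union>y\<in>{y \<in> P. y < x}. edge_vecs y) \<subseteq> F2.span (old x) \<and>
     new x \<subseteq> edge_vecs x \<and> old x \<inter> new x = {} \<and> F2.independent (old x \<union> new x) \<and>
     edge_vecs x \<subseteq> F2.span (old x \<union> new x)"
proof -
  have "\<exists>S N. S \<subseteq> (\<Union>y\<in>{y \<in> P. y < x}. edge_vecs y) \<and>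
     (\<Union>y\<in>{y \<in> P. y < x}. edge_vecs y) \<subseteq> F2.span S \<and>
     N \<subseteq> edge_vecs x \<and> S \<inter> N = {} \<and> F2.independent (S \<union> N) \<and>
     edge_vecs x \<subseteq> F2.span (S \<union> N)" (is "\<exists>S N. ?Q S N") if x: "x \<in> P" for x
  proof -
    let ?O = "\<Union>y\<in>{y \<in> P. y < x}. edge_vecs y"
    obtain S where S: "S \<subseteq> ?O" "F2.independent S" "?O \<subseteq> F2.span S"
      by (rule F2.maximal_independent_subset)
    have "S \<subseteq> edge_vecs x" using S(1) edge_vecs_mono x by fastforce
    then obtain B where B: "S \<subseteq> B" "B \<subseteq> edge_vecs x" "F2.independent B"
      "edge_vecs x \<subseteq> F2.span B"
      using S(2) by (rule F2.maximal_independent_subset_extend)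
    have "S \<union> (B - S) = B" using B by auto
    then have "?Q S (B - S)" using S B by auto
    then show ?thesis by blast
  qed
  then show ?thesis by (intro bchoice2)
qed

end

text \<open>The numbers in \<open>I\<close> stand for pairs of a grade and a relation, because one
  vector may be new at several incomparable grades; it then gives parallel edges.\<close>

locale presented_module = generated_module P M X \<tau> J h s
  for P :: "'p::order set" and M :: "('p, 'b) pmodule" and X \<tau> J h s +
  fixes old new :: "'p \<Rightarrow> (nat \<Rightarrow>\<^sub>0 bit) set"
    and I :: "nat set" and g :: "nat \<Rightarrow> 'p" and rel :: "nat \<Rightarrow> (nat \<Rightarrow>\<^sub>0 bit)"
  assumes old_subset: "x \<in> P \<Longrightarrow> old x \<subseteq> (\<Union>y\<in>{y \<in> P. y < x}. edge_vecs y)"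
    and old_span: "x \<in> P \<Longrightarrow> y \<in> P \<Longrightarrow> y < x \<Longrightarrow> edge_vecs y \<subseteq> F2.span (old x)"
    and new_subset: "x \<in> P \<Longrightarrow> new x \<subseteq> edge_vecs x"
    and disjoint: "x \<in> P \<Longrightarrow> old x \<inter> new x = {}"
    and independent: "x \<in> P \<Longrightarrow> F2.independent (old x \<union> new x)"
    and span_relations: "x \<in> P \<Longrightarrow> edge_vecs x \<subseteq> F2.span (old x \<union> new x)"
    and finite_I: "finite I"
    and bij_relations: "bij_betw (\<lambda>i. (g i, rel i)) I (SIGMA x:P. new x)"
begin

section \<open>Exactness of the presentation\<close>

lemma relation:
  assumes "i \<in> I"
  shows "g i \<in> P" "rel i \<in> new (g i)"
  using bij_betw_apply[OF bij_relations assms] by auto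

lemma old_subset_edge_vecs:
  assumes "x \<in> P"
  shows "old x \<subseteq> edge_vecs x"
  using old_subset[OF assms] edge_vecs_mono assms by fastforce

text \<open>Induction along \<open>P\<close>: the vectors of \<open>old x\<close> are edges of a
  lower grade and thus spanned by the relations born up to there, while those of
  \<open>new x\<close> are relations born at \<open>x\<close>.\<close>

lemma span_relations_below:
  assumes "x \<in> P"
  shows "F2.span (rel ` {i \<in> I. g i \<le> x}) = F2.span (edge_vecs x)"
proof
  have "rel ` {i \<in> I. g i \<le> x} \<subseteq> edge_vecs x"
    using relation new_subset edge_vecs_mono assms by blast
  then show "F2.span (rel ` {i \<in> I. g i \<le> x}) \<subseteq> F2.span (edge_vecs x)"
    by (rule F2.span_mono)
  have "edge_vecs x \<subseteq> F2.span (rel ` {i \<in> I. g i \<le> x})"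
    using finite_P assms
  proof (induction x rule: finite_poset_induct)
    case (less x)
    have "new x \<subseteq> rel ` {i \<in> I. g i \<le> x}"
    proof
      fix v assume "v \<in> new x"
      then have "(x, v) \<in> (\<lambda>i. (g i, rel i)) ` I"
        using bij_betw_imp_surj_on[OF bij_relations] less by auto
      then show "v \<in> rel ` {i \<in> I. g i \<le> x}" by auto
    qed
    moreover have "old x \<subseteq> F2.span (rel ` {i \<in> I. g i \<le> x})"
    proof
      fix v assume "v \<in> old x"
      then obtain y where y: "y \<in> P" "y < x" "v \<in> edge_vecs y"
        using old_subset less by blast
      have "F2.span (rel ` {i \<in> I. g i \<le> y}) \<subseteq> F2.span (rel ` {i \<in> I. g i \<le> x})"
        by (rule F2.span_mono) (use y in auto)
      then show "v \<in> F2.span (rel ` {i \<in> I. g i \<le> x})" using less y by blast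
    qed
    ultimately have "old x \<union> new x \<subseteq> F2.span (rel ` {i \<in> I. g i \<le> x})"
      using F2.span_superset by blast
    then show ?case
      using span_relations[OF less.hyps] F2.span_minimal[OF _ F2.subspace_span] by blast
  qed
  then show "F2.span (edge_vecs x) \<subseteq> F2.span (rel ` {i \<in> I. g i \<le> x})"
    by (rule F2.span_minimal[OF _ F2.subspace_span])
qed

text \<open>One map serves at every grade because the transition maps of \<open>proj_sum\<close> are
  inclusions. Exactness combines \<open>span_relations_below\<close> with the description of the
  kernel by edges.\<close>

lemma presentation: "projective_presentation P M J h I g (\<lambda>x. linear_extension rel)"
proof -
  have exact: "linear_extension rel ` free_on {i \<in> I. g i \<le> x}
      = {v \<in> free_on (below x). cover x v = 0}" if "x \<in> P" for x
    using that by (simp add: linear_extension_image_free_on span_relations_below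
        kernel_eq_span_edge_vecs)
  then have lin: "linear_between (free_on {i \<in> I. g i \<le> x}) (free_on (below x))
      (linear_extension rel)" if "x \<in> P" for x
    using that linear_between_linear_extension_UNIV[of "free_on {i \<in> I. g i \<le> x}" rel]
    unfolding linear_between_def by auto
  have "pmodule_morphism P (proj_sum I g) (proj_sum J h) (\<lambda>x. linear_extension rel)"
    using persistence_module_proj_sum[OF finite_J, of P h]
      persistence_module_proj_sum[OF finite_I, of P g] lin
    unfolding pmodule_morphism_def by (auto simp: proj_sum_def)
  then show ?thesis
    unfolding projective_presentation_def
  proof (intro conjI exI[of _ cover] ballI)
    show "h ` J \<subseteq> P" "g ` I \<subseteq> P" using h_in relation(1) by auto
  qed (use finite_J finite_I cover_morphism cover_surj exact
      in \<open>simp_all add: proj_sum_def space\<close>)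
qed

section \<open>Comparison with a competing presentation\<close>

context
  fixes J' :: "'j set" and h' :: "'j \<Rightarrow> 'p" and I' :: "'i set" and g' :: "'i \<Rightarrow> 'p"
    and q0 q1
  assumes J': "finite J'" "h' ` J' \<subseteq> P" and I': "finite I'" "g' ` I' \<subseteq> P"
    and q0: "pmodule_morphism P (proj_sum J' h') M q0"
    and q1: "pmodule_morphism P (proj_sum I' g') (proj_sum J' h') q1"
    and q0_surj: "\<And>x. x \<in> P \<Longrightarrow> q0 x ` free_on {j \<in> J'. h' j \<le> x} = free_on (X x)"
    and q1_exact: "\<And>x. x \<in> P \<Longrightarrow> {v \<in> free_on {j \<in> J'. h' j \<le> x}. q0 x v = 0}
      = q1 x ` free_on {i \<in> I'. g' i \<le> x}"
begin

lemma q0_linear: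
  "x \<in> P \<Longrightarrow> linear_between (free_on {j \<in> J'. h' j \<le> x}) (free_on (X x)) (q0 x)"
  using q0 by (simp add: pmodule_morphism_def proj_sum_def space)

lemma q0_natural:
  assumes "x \<in> P" "y \<in> P" "x \<le> y" "v \<in> free_on {j \<in> J'. h' j \<le> x}"
  shows "q0 y v = linear_extension (\<tau> x y) (q0 x v)"
proof -
  have "v \<in> space_at (proj_sum J' h') x" using assms by (simp add: proj_sum_def)
  then have "q0 y (trans_map (proj_sum J' h') x y v) = trans_map M x y (q0 x v)"
    using q0 assms(1-3) unfolding pmodule_morphism_def by blast
  then show ?thesis by (simp add: proj_sum_def trans)
qed

lemma q1_natural:
  assumes "x \<in> P" "y \<in> P" "x \<le> y" "v \<in> free_on {i \<in> I'. g' i \<le> x}"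
  shows "q1 y v = q1 x v"
proof -
  have "v \<in> space_at (proj_sum I' g') x" using assms by (simp add: proj_sum_def)
  then have "q1 y (trans_map (proj_sum I' g') x y v)
      = trans_map (proj_sum J' h') x y (q1 x v)"
    using q1 assms(1-3) unfolding pmodule_morphism_def by blast
  then show ?thesis by (simp add: proj_sum_def)
qed

text \<open>Competing generators older than \<open>x\<close> map into the span of the decomposable
  elements, so those born at \<open>x\<close> must account for all other elements of
  \<open>X x\<close>.\<close>

lemma card_generators_le: "card J \<le> card J'"
proof (rule card_le_by_fibres[OF finite_P finite_J J'(1) _ J'(2)])
  show "h ` J \<subseteq> P" using h_in by auto
  fix x assume x: "x \<in> P"
  have s_image: "s ` {j \<in> J. h j = x} = X x - decomposable x"
    using generator generator_exists[OF x] by fastforce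
  have "inj_on s {j \<in> J. h j = x}" using generator_unique by (auto intro: inj_onI)
  then have "card {j \<in> J. h j = x} = card (basis_vec ` (X x - decomposable x))"
    using s_image inj_basis_vec by (metis card_image inj_on_subset subset_UNIV)
  also have "\<dots> \<le> card {j \<in> J'. h' j = x}"
  proof (rule card_new_generators_le[OF J'(1) q0_linear[OF x],
        where S = "basis_vec ` decomposable x"])
    have D: "decomposable x \<subseteq> X x" by (auto simp: decomposable_def)
    then have eq: "basis_vec ` decomposable x \<union> basis_vec ` (X x - decomposable x)
        = basis_vec ` X x" by auto
    show "basis_vec ` decomposable x \<union> basis_vec ` (X x - decomposable x)
        \<subseteq> q0 x ` free_on {j \<in> J'. h' j \<le> x}"
      unfolding eq q0_surj[OF x] by (auto intro: basis_vec_in_free_on)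
    show "F2.independent (basis_vec ` decomposable x \<union> basis_vec ` (X x - decomposable x))"
      unfolding eq by (rule independent_basis_vec)
    show "finite (basis_vec ` decomposable x)"
      using finite_subset[OF D finite_X[OF x]] by simp
    show "basis_vec ` decomposable x \<inter> basis_vec ` (X x - decomposable x) = {}"
      using inj_basis_vec by (auto simp: inj_def)
    fix j assume j: "j \<in> J'" "h' j < x"
    let ?y = "h' j"
    have y: "?y \<in> P" using j J' by auto
    have e: "basis_vec j \<in> free_on {j \<in> J'. h' j \<le> ?y}"
      using j by (simp add: basis_vec_in_free_on)
    have "\<tau> ?y x ` X ?y \<subseteq> F2.span (basis_vec ` decomposable x)"
    proof safe
      fix c assume c: "c \<in> X ?y"
      show "\<tau> ?y x c \<in> F2.span (basis_vec ` decomposable x)"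
      proof (cases "\<tau> ?y x c = 0")
        case True
        then show ?thesis by (simp add: F2.span_zero)
      next
        case False
        then obtain d where d: "d \<in> X x" "\<tau> ?y x c = basis_vec d"
          using monomial[OF y x less_imp_le[OF j(2)] c] by auto
        then have "basis_vec d \<in> \<tau> ?y x ` X ?y" using c by (metis imageI)
        then have "d \<in> decomposable x" using d j y by (auto simp: decomposable_def)
        then show ?thesis using d by (simp add: F2.span_base)
      qed
    qed
    then have "linear_extension (\<tau> ?y x) ` free_on (X ?y)
        \<subseteq> F2.span (basis_vec ` decomposable x)"
      unfolding linear_extension_image_free_on by (rule F2.span_minimal) (rule F2.subspace_span)
    moreover have "q0 ?y (basis_vec j) \<in> free_on (X ?y)" using q0_surj[OF y] e by blast
    moreover have "q0 x (basis_vec j) = linear_extension (\<tau> ?y x) (q0 ?y (basis_vec j))"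
      by (rule q0_natural[OF y x _ e]) (use j in auto)
    ultimately show "q0 x (basis_vec j) \<in> F2.span (basis_vec ` decomposable x)" by auto
  qed
  finally show "card {j \<in> J. h j = x} \<le> card {j \<in> J'. h' j = x}" .
qed

text \<open>This is projectivity: each generator is lifted at its birth grade, and naturality of
  \<open>cover\<close> and \<open>q0\<close> carries the equation to all later grades. Hence a
  single \<phi> works for every \<open>x\<close>.\<close>

lemma lift_exists:
  "\<exists>\<phi>. \<forall>x\<in>P. \<forall>v\<in>free_on {j \<in> J'. h' j \<le> x}.
     linear_extension \<phi> v \<in> free_on (below x) \<and> cover x (linear_extension \<phi> v) = q0 x v"
proof -
  have "\<exists>u\<in>free_on (below (h' j)). cover (h' j) u = q0 (h' j) (basis_vec j)"
    if j: "j \<in> J'" for j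
  proof -
    have y: "h' j \<in> P" using j J' by auto
    have "q0 (h' j) (basis_vec j) \<in> free_on (X (h' j))"
      using q0_surj[OF y] j by (auto simp: basis_vec_in_free_on)
    then show ?thesis using cover_surj[OF y] by force
  qed
  then obtain \<phi> where \<phi>: "\<And>j. j \<in> J' \<Longrightarrow> \<phi> j \<in> free_on (below (h' j))"
    "\<And>j. j \<in> J' \<Longrightarrow> cover (h' j) (\<phi> j) = q0 (h' j) (basis_vec j)" by metis
  have "linear_extension \<phi> v \<in> free_on (below x) \<and> cover x (linear_extension \<phi> v) = q0 x v"
    if x: "x \<in> P" and v: "v \<in> free_on {j \<in> J'. h' j \<le> x}" for x v
  proof
    have sub: "\<phi> j \<in> free_on (below x)" if "j \<in> J'" "h' j \<le> x" for j
      using \<phi>(1)[OF that(1)] that by (auto simp: free_on_def intro: order_trans)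
    have "linear_extension \<phi> ` free_on {j \<in> J'. h' j \<le> x} \<subseteq> free_on (below x)"
      by (rule linear_image_free_on_subset[OF linear_between_linear_extension_UNIV
            subspace_free_on])
        (use sub in \<open>auto simp: linear_extension_basis_vec\<close>)
    then show "linear_extension \<phi> v \<in> free_on (below x)" using v by auto
    have lin: "linear_between (free_on {j \<in> J'. h' j \<le> x}) UNIV
        (\<lambda>v. cover x (linear_extension \<phi> v) - q0 x v)"
      using q0_linear[OF x] unfolding linear_between_def
      by (auto simp: linear_extension_add linear_extension_scale cover_add cover_scale
          F2.scale_right_diff_distrib)
    \<comment> \<open>The difference is linear, so it suffices that it vanishes on basis
      vectors.\<close>
    have "(\<lambda>v. cover x (linear_extension \<phi> v) - q0 x v) ` free_on {j \<in> J'. h' j \<le> x} \<subseteq> {0}"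
    proof (rule linear_image_free_on_subset[OF lin F2.subspace_single_0])
      fix j assume "j \<in> {j \<in> J'. h' j \<le> x}"
      then have j: "j \<in> J'" "h' j \<le> x" "h' j \<in> P" using J' by auto
      have "cover x (\<phi> j) = linear_extension (\<tau> (h' j) x) (cover (h' j) (\<phi> j))"
        using cover_natural[OF j(3) x j(2) \<phi>(1)[OF j(1)]] by simp
      also have "\<dots> = linear_extension (\<tau> (h' j) x) (q0 (h' j) (basis_vec j))"
        by (simp only: \<phi>(2)[OF j(1)])
      also have "\<dots> = q0 x (basis_vec j)"
        using q0_natural[OF j(3) x j(2), of "basis_vec j"] j
        by (simp add: basis_vec_in_free_on)
      finally show "cover x (linear_extension \<phi> (basis_vec j)) - q0 x (basis_vec j) \<in> {0}"
        by (simp add: linear_extension_basis_vec)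
    qed
    then have "(\<lambda>v. cover x (linear_extension \<phi> v) - q0 x v) v \<in> {0}" using v by blast
    then show "cover x (linear_extension \<phi> v) = q0 x v" by simp
  qed
  then show ?thesis by blast
qed

text \<open>Nakayama's lemma: the kernel of the cover lies in the radical, so a map onto \<open>M\<close>
  lifts to a map onto the cover.\<close>

lemma lift_surj:
  assumes \<phi>: "\<And>x v. x \<in> P \<Longrightarrow> v \<in> free_on {j \<in> J'. h' j \<le> x} \<Longrightarrow>
      linear_extension \<phi> v \<in> free_on (below x) \<and> cover x (linear_extension \<phi> v) = q0 x v"
    and x: "x \<in> P"
  shows "free_on (below x) \<subseteq> linear_extension \<phi> ` free_on {j \<in> J'. h' j \<le> x}"
  using finite_P x
proof (induction x rule: finite_poset_induct)
  case (less x)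
  let ?R = "linear_extension \<phi> ` free_on {j \<in> J'. h' j \<le> x}"
  have R: "F2.subspace ?R" unfolding linear_extension_image_free_on by (rule F2.subspace_span)
  have lower: "free_on {j \<in> J. h j < x} \<subseteq> ?R"
    unfolding free_on_eq_span[of "{j \<in> J. h j < x}"]
  proof (rule F2.span_minimal[OF _ R], safe)
    fix j assume j: "j \<in> J" "h j < x"
    have "basis_vec j \<in> free_on (below (h j))" using j by (simp add: basis_vec_in_free_on)
    then have "basis_vec j \<in> linear_extension \<phi> ` free_on {i \<in> J'. h' i \<le> h j}"
      using less.IH[of "h j"] j h_in by blast
    moreover have "free_on {i \<in> J'. h' i \<le> h j} \<subseteq> free_on {i \<in> J'. h' i \<le> x}"
      using j by (auto simp: free_on_def)
    ultimately show "basis_vec j \<in> ?R" by blast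
  qed
  show ?case
  proof
    fix v assume v: "v \<in> free_on (below x)"
    then have "cover x v \<in> q0 x ` free_on {j \<in> J'. h' j \<le> x}"
      using cover_surj[OF less.hyps] q0_surj[OF less.hyps] by blast
    then obtain u where u: "u \<in> free_on {j \<in> J'. h' j \<le> x}" "q0 x u = cover x v"
      by (metis (no_types, lifting) image_iff)
    let ?w = "linear_extension \<phi> u"
    have w: "?w \<in> free_on (below x)" "cover x ?w = cover x v"
      using \<phi>[OF less.hyps u(1)] u(2) by auto
    \<comment> \<open>The vector \<open>?w\<close> lifts a preimage of \<open>cover x v\<close>, so
      it agrees with \<open>v\<close> up to the kernel of the cover, hence up to generators born
      before \<open>x\<close>, which the induction hypothesis has already reached.\<close>
    have "cover x (v + ?w) = cover x v - cover x v"
      by (simp only: cover_add w(2) diff_eq_add_bit)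
    then have "v + ?w \<in> free_on {j \<in> J. h j < x}"
      using v w less.hyps
      by (intro kernel_in_radical) (auto intro: F2.subspace_add[OF subspace_free_on])
    then have "v + ?w \<in> ?R" using lower by blast
    then have "v + ?w - ?w \<in> ?R" using R u by (intro F2.subspace_diff) auto
    then show "v \<in> ?R" by simp
  qed
qed

text \<open>The argument of \<open>card_generators_le\<close> is repeated one step further left, for
  the kernel of the cover: \<open>old x\<close> plays the part of the decomposable elements and
  \<open>new x\<close> that of the others.\<close>

lemma card_relations_le: "card I \<le> card I'"
proof -
  obtain \<phi> where \<phi>: "\<And>x v. x \<in> P \<Longrightarrow> v \<in> free_on {j \<in> J'. h' j \<le> x} \<Longrightarrow>
      linear_extension \<phi> v \<in> free_on (below x) \<and> cover x (linear_extension \<phi> v) = q0 x v"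
    using lift_exists by blast
  let ?f = "\<lambda>x v. linear_extension \<phi> (q1 x v)"
  have q1_lin: "linear_between (free_on {i \<in> I'. g' i \<le> x}) (free_on {j \<in> J'. h' j \<le> x}) (q1 x)"
    if "x \<in> P" for x
    using q1 that by (simp add: pmodule_morphism_def proj_sum_def)
  have f_lin: "linear_between (free_on {i \<in> I'. g' i \<le> x}) UNIV (?f x)" if "x \<in> P" for x
    using q1_lin[OF that] unfolding linear_between_def
    by (auto simp: linear_extension_add linear_extension_scale)
  have f_image: "?f x ` free_on {i \<in> I'. g' i \<le> x} = F2.span (edge_vecs x)" if x: "x \<in> P" for x
  proof -
    have "?f x ` free_on {i \<in> I'. g' i \<le> x}
        = linear_extension \<phi> ` {v \<in> free_on {j \<in> J'. h' j \<le> x}. q0 x v = 0}"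
      by (simp add: q1_exact[OF x] image_image)
    \<comment> \<open>If \<open>cover x v = 0\<close>, then any preimage \<open>u\<close> of
      \<open>v\<close> under the lift satisfies \<open>q0 x u = cover x v = 0\<close>, so
      surjectivity of the lift passes to the kernels.\<close>
    also have "\<dots> = {v \<in> free_on (below x). cover x v = 0}"
      using \<phi>[OF x] lift_surj[OF \<phi> x] by fastforce
    finally show ?thesis by (simp add: kernel_eq_span_edge_vecs[OF x])
  qed
  show ?thesis
  proof (rule card_le_by_fibres[OF finite_P finite_I I'(1) _ I'(2)])
    show "g ` I \<subseteq> P" using relation by auto
    fix x assume x: "x \<in> P"
    have "rel ` {i \<in> I. g i = x} \<subseteq> new x" using relation by auto
    moreover have "inj_on rel {i \<in> I. g i = x}"
      using bij_betw_imp_inj_on[OF bij_relations] by (auto simp: inj_on_def)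
    moreover have "finite (new x)"
      using new_subset[OF x] finite_edge_vecs finite_subset by blast
    ultimately have "card {i \<in> I. g i = x} \<le> card (new x)"
      by (intro card_inj_on_le[where f = rel]) auto
    also have "\<dots> \<le> card {i \<in> I'. g' i = x}"
    proof (rule card_new_generators_le[OF I'(1) f_lin[OF x]])
      show "old x \<union> new x \<subseteq> ?f x ` free_on {i \<in> I'. g' i \<le> x}"
        unfolding f_image[OF x] using old_subset_edge_vecs[OF x] new_subset[OF x]
        by (auto intro: F2.span_base)
      show "finite (old x)"
        using old_subset_edge_vecs[OF x] finite_edge_vecs finite_subset by blast
      show "old x \<inter> new x = {}" "F2.independent (old x \<union> new x)"
        using disjoint independent x by auto
      fix i assume i: "i \<in> I'" "g' i < x"
      have y: "g' i \<in> P" using i I' by auto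
      have e: "basis_vec i \<in> free_on {k \<in> I'. g' k \<le> g' i}"
        using i by (simp add: basis_vec_in_free_on)
      have "q1 x (basis_vec i) = q1 (g' i) (basis_vec i)"
        by (rule q1_natural[OF y x less_imp_le[OF i(2)] e])
      then have "?f x (basis_vec i) \<in> F2.span (edge_vecs (g' i))"
        using f_image[OF y] e by auto
      moreover have "F2.span (edge_vecs (g' i)) \<subseteq> F2.span (old x)"
        by (rule F2.span_minimal[OF old_span[OF x y i(2)] F2.subspace_span])
      ultimately show "?f x (basis_vec i) \<in> F2.span (old x)" by blast
    qed
    finally show "card {i \<in> I. g i = x} \<le> card {i \<in> I'. g' i = x}" .
  qed
qed

end

lemma minimal_presentation:
  "minimal_projective_presentation P M J h I g (\<lambda>x. linear_extension rel)"
  unfolding minimal_projective_presentation_def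
proof (intro conjI presentation allI impI)
  fix J' :: "nat set" and h' and I' :: "nat set" and g' q1
  assume pres: "projective_presentation P M J' h' I' g' q1"
  then obtain q0 where q0: "pmodule_morphism P (proj_sum J' h') M q0"
    "\<And>x. x \<in> P \<Longrightarrow> q0 x ` free_on {j \<in> J'. h' j \<le> x} = free_on (X x)"
    "\<And>x. x \<in> P \<Longrightarrow> {v \<in> free_on {j \<in> J'. h' j \<le> x}. q0 x v = 0}
      = q1 x ` free_on {i \<in> I'. g' i \<le> x}"
    unfolding projective_presentation_def by (auto simp: proj_sum_def space)
  have p: "finite J'" "h' ` J' \<subseteq> P" "finite I'" "g' ` I' \<subseteq> P"
    "pmodule_morphism P (proj_sum I' g') (proj_sum J' h') q1"
    using pres unfolding projective_presentation_def by auto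
  show "card J \<le> card J'" by (rule card_generators_le[OF p(1-4) q0(1) p(5) q0(2,3)])
  show "card I \<le> card I'" by (rule card_relations_le[OF p(1-4) q0(1) p(5) q0(2,3)])
qed

end


section \<open>Irrelevance of grades off the index sets, and existence of the choices\<close>

lemma proj_sum_cong:
  assumes "\<And>i. i \<in> I \<Longrightarrow> g i = g' i"
  shows "proj_sum I g = proj_sum I g'"
proof -
  have "{i \<in> I. g i \<le> y} = {i \<in> I. g' i \<le> y}" for y using assms by auto
  then show ?thesis by (simp add: proj_sum_def)
qed

text \<open>The grades read off from the graph are known to equal \<open>h\<close> and
  \<open>g\<close> only on the index sets; this permits exchanging them.\<close>

lemma minimal_projective_presentation_cong:
  assumes "\<And>j. j \<in> J \<Longrightarrow> h j = h' j" "\<And>i. i \<in> I \<Longrightarrow> g i = g' i"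
  shows "minimal_projective_presentation P M J h I g q =
    minimal_projective_presentation P M J h' I g' q"
proof -
  have "h ` J = h' ` J" "g ` I = g' ` I" using assms by auto
  then show ?thesis
    using proj_sum_cong[of J h h', OF assms(1)] proj_sum_cong[of I g g', OF assms(2)]
    by (simp add: minimal_projective_presentation_def projective_presentation_def)
qed

lemma (in generated_module) ex_presented_module:
  "\<exists>old new (I :: nat set) g rel. presented_module P M X \<tau> J h s old new I g rel"
proof -
  obtain old new where rel: "\<forall>x\<in>P.
     old x \<subseteq> (\<Union>y\<in>{y \<in> P. y < x}. edge_vecs y) \<and>
     (\<Union>y\<in>{y \<in> P. y < x}. edge_vecs y) \<subseteq> F2.span (old x) \<and>
     new x \<subseteq> edge_vecs x \<and> old x \<inter> new x = {} \<and> F2.independent (old x \<union> new x) \<and>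
     edge_vecs x \<subseteq> F2.span (old x \<union> new x)"
    using relation_bases_exist by (elim exE)
  have "finite (new x)" if "x \<in> P" for x
    using rel that finite_edge_vecs finite_subset by blast
  then have "finite (SIGMA x:P. new x)" using finite_P by auto
  then obtain e where e: "bij_betw e {1..card (SIGMA x:P. new x)} (SIGMA x:P. new x)"
    using ex_bij_betw_nat_finite_1 by blast
  have "presented_module P M X \<tau> J h s old new {1..card (SIGMA x:P. new x)} (fst \<circ> e) (snd \<circ> e)"
  proof
    show "edge_vecs y \<subseteq> F2.span (old x)" if "x \<in> P" "y \<in> P" "y < x" for x y
      using rel that by blast
  qed (use rel e in auto)
  then show ?thesis by blast
qed

lemma (in monomial_module) ex_generated_module:
  "\<exists>J h s. generated_module P M X \<tau> J h s"
proof -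
  let ?S = "SIGMA x:P. X x - decomposable x"
  have "finite ?S" using finite_P finite_X by auto
  \<comment> \<open>Numbering from \<open>1\<close> keeps \<open>0\<close> free for the
    distinguished vertex.\<close>
  then obtain e where e: "bij_betw e {1..card ?S} ?S"
    using ex_bij_betw_nat_finite_1 by blast
  have "generated_module P M X \<tau> {1..card ?S} (fst \<circ> e) (snd \<circ> e)"
  proof
    show "(fst \<circ> e) j \<in> P" if "j \<in> {1..card ?S}" for j
      using bij_betw_apply[OF e that] by auto
  qed (use e in auto)
  then show ?thesis by blast
qed

text \<open>A relation is stored only as a vector; its endpoints are recovered here, both alive when
  the edge is born.\<close>

lemma (in presented_module) ex_faces:
  "\<exists>f0 f1. \<forall>i\<in>I. f0 i \<in> vertices (g i) \<and> f1 i \<in> vertices (g i) \<and>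
     rel i = vertex_vec (f0 i) + vertex_vec (f1 i)"
proof -
  have "\<exists>a b. a \<in> vertices (g i) \<and> b \<in> vertices (g i) \<and> rel i = vertex_vec a + vertex_vec b"
    if "i \<in> I" for i
  proof -
    have "rel i \<in> edge_vecs (g i)" using relation[OF that] new_subset by blast
    then show ?thesis unfolding edge_vecs_def by blast
  qed
  then show ?thesis by (intro bchoice2)
qed

section \<open>The filtered graph\<close>

definition graph_of ::
    "'j set \<Rightarrow> ('j \<Rightarrow> 'q::order) \<Rightarrow> 'i set \<Rightarrow> ('i \<Rightarrow> 'q) \<Rightarrow> ('i \<Rightarrow> 'j) \<Rightarrow> ('i \<Rightarrow> 'j) \<Rightarrow>
      'q \<Rightarrow> ('j, 'i) graph" where
  "graph_of V h I g f0 f1 x =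
     \<lparr>verts = {v \<in> V. h v \<le> x}, edges = {i \<in> I. g i \<le> x}, face0 = f0, face1 = f1\<rparr>"

locale graded_graph =
  fixes Q :: "'q::order set" and V :: "'j set" and h :: "'j \<Rightarrow> 'q"
    and I :: "'i set" and g :: "'i \<Rightarrow> 'q" and f0 f1 :: "'i \<Rightarrow> 'j"
  assumes finite: "finite V" "finite I"
    and h_in: "v \<in> V \<Longrightarrow> h v \<in> Q" and g_in: "i \<in> I \<Longrightarrow> g i \<in> Q"
    and faces: "i \<in> I \<Longrightarrow> f0 i \<in> V \<and> f1 i \<in> V \<and> h (f0 i) \<le> g i \<and> h (f1 i) \<le> g i"
begin

abbreviation graph :: "'q \<Rightarrow> ('j, 'i) graph" where
  "graph \<equiv> graph_of V h I g f0 f1"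

lemma all_verts: "all_verts Q graph = V"
  using h_in by (auto simp: all_verts_def graph_of_def)

lemma all_edges: "all_edges Q graph = I"
  using g_in by (auto simp: all_edges_def graph_of_def)

lemma filtered: "filtered_graph Q graph"
  using finite faces
  by (fastforce simp: filtered_graph_def delta_graph_def subgraph_def graph_of_def
      intro: order_trans)

text \<open>Two grades with the same elements of \<open>Q\<close> above them coincide by
  antisymmetry, so birth grades are unique.\<close>

lemma vertex_born_iff: "v \<in> V \<Longrightarrow> vertex_born Q graph v x \<longleftrightarrow> x = h v"
  using h_in by (auto simp: vertex_born_def graph_of_def intro: antisym)

lemma edge_born_iff: "i \<in> I \<Longrightarrow> edge_born Q graph i x \<longleftrightarrow> x = g i"
  using g_in by (auto simp: edge_born_def graph_of_def intro: antisym)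

lemma vertex_grade: "v \<in> V \<Longrightarrow> vertex_grade Q graph v = h v"
  by (simp add: vertex_grade_def vertex_born_iff)

lemma edge_grade: "i \<in> I \<Longrightarrow> edge_grade Q graph i = g i"
  by (simp add: edge_grade_def edge_born_iff)

lemma entry_boundary_matrix:
  "entry (boundary_matrix Q graph) v i = of_bool (v = f0 i) + of_bool (v = f1 i)"
  by (simp add: boundary_matrix_def graph_of_def)

lemma graded_boundary_matrix: "graded_matrix Q (boundary_matrix Q graph)"
proof -
  have "h v \<le> g i" if "i \<in> I" "entry (boundary_matrix Q graph) v i \<noteq> 0" for v i
    using faces[OF that(1)] that(2) by (auto simp: entry_boundary_matrix split: if_splits)
  then show ?thesis
    using finite h_in g_in unfolding graded_matrix_def
    by (auto simp: boundary_matrix_def all_verts all_edges vertex_grade edge_grade)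
qed

end

text \<open>The properties of a tower enter only here: a simplex goes to a simplex, or to
  \<open>0\<close> if its image has too few vertices.\<close>

lemma chain_module_monomial:
  assumes "finite P" "poset_tower P K"
  shows "monomial_module P (chain_module l K) (\<lambda>x. simplices l (complex_at K x))
    (\<lambda>x y \<sigma>. if vertex_map K x y ` \<sigma> \<in> simplices l (complex_at K y)
      then basis_vec (vertex_map K x y ` \<sigma>) else 0)"
proof
  show "finite (simplices l (complex_at K x))" if "x \<in> P" for x
    using assms that by (auto simp: poset_tower_def simplicial_complex_def simplices_def)
  show "persistence_module P (chain_module l K)"
    using assms(2) by (rule persistence_module_chain_module)
qed (use assms in \<open>auto simp: chain_module_def\<close>)

section \<open>Assembling the graph and its boundary matrix\<close>

theorem theorem23:
  fixes P :: "'p::order set" and K :: "('p, 'v) tower" and l :: nat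
  assumes "finite P" and "poset_tower P K"
  shows "\<exists>(G :: 'p option \<Rightarrow> (nat, nat) graph) (\<Omega> :: nat).
    filtered_graph (with_bot P) G \<and>
    (\<forall>v\<in>all_verts (with_bot P) G. \<exists>!x. vertex_born (with_bot P) G v x) \<and>
    (\<forall>e\<in>all_edges (with_bot P) G. \<exists>!x. edge_born (with_bot P) G e x) \<and>
    vertex_born (with_bot P) G \<Omega> None \<and>
    graded_matrix (with_bot P) (boundary_matrix (with_bot P) G) \<and>
    graded_matrix (Some ` P) (delete_row \<Omega> (boundary_matrix (with_bot P) G)) \<and>
    minimal_presentation_matrix P (chain_module l K)
      (unlift_grades (delete_row \<Omega> (boundary_matrix (with_bot P) G)))"
proof -
  let ?M = "chain_module l K" and ?X = "\<lambda>x. simplices l (complex_at K x)"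
  let ?\<tau> = "\<lambda>x y \<sigma>. if vertex_map K x y ` \<sigma> \<in> ?X y then basis_vec (vertex_map K x y ` \<sigma>) else 0"
  obtain J h s where "generated_module P ?M ?X ?\<tau> J h s"
    using monomial_module.ex_generated_module[OF chain_module_monomial[OF assms]] by blast
  then interpret gen: generated_module P ?M ?X ?\<tau> J h s .
  obtain old new and I :: "nat set" and g rel
    where "presented_module P ?M ?X ?\<tau> J h s old new I g rel"
    using gen.ex_presented_module by blast
  then interpret pres: presented_module P ?M ?X ?\<tau> J h s old new I g rel .
  obtain f0 f1 where f: "\<And>i. i \<in> I \<Longrightarrow> f0 i \<in> gen.vertices (g i)"
    "\<And>i. i \<in> I \<Longrightarrow> f1 i \<in> gen.vertices (g i)"
    "\<And>i. i \<in> I \<Longrightarrow> rel i = gen.vertex_vec (f0 i) + gen.vertex_vec (f1 i)"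
    using pres.ex_faces by blast
  \<comment> \<open>The number \<open>0\<close> becomes \<Omega>, born at the new bottom
    \<open>None\<close>; every other vertex keeps the grade of its generator.\<close>
  let ?Q = "with_bot P" and ?h = "\<lambda>v. if v = 0 then None else Some (h v)"
  interpret graph: graded_graph ?Q "insert 0 J" ?h I "\<lambda>i. Some (g i)" f0 f1
  proof
    fix i assume "i \<in> I"
    with f(1,2)[of i] gen.zero_notin_J
    show "f0 i \<in> insert 0 J \<and> f1 i \<in> insert 0 J \<and> ?h (f0 i) \<le> Some (g i) \<and> ?h (f1 i) \<le> Some (g i)"
      by (auto simp: gen.vertices_def)
  qed (use gen.finite_J pres.finite_I gen.h_in pres.relation in \<open>auto simp: with_bot_def\<close>)
  let ?B = "boundary_matrix ?Q graph.graph"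
  let ?A = "unlift_grades (delete_row 0 ?B)"
  have rows: "rows ?B = insert 0 J" "cols ?B = I"
    by (simp_all add: boundary_matrix_def graph.all_verts graph.all_edges)
  have grades: "row_grade ?B j = Some (h j)" if "j \<in> J" for j
  proof -
    have "j \<noteq> 0" using that gen.zero_notin_J by metis
    then show ?thesis using graph.vertex_grade[of j] that by (simp add: boundary_matrix_def)
  qed
  have col_grades: "col_grade ?B i = Some (g i)" if "i \<in> I" for i
    using graph.edge_grade[of i] that by (simp add: boundary_matrix_def)
  have A: "rows ?A = J" "cols ?A = I" "entry ?A = entry ?B"
    using rows gen.zero_notin_J by (auto simp: unlift_grades_def delete_row_def)
  have A_row: "row_grade ?A j = h j" if "j \<in> J" for j
    using grades[OF that] by (simp add: unlift_grades_def delete_row_def)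
  have A_col: "col_grade ?A i = g i" if "i \<in> I" for i
    using col_grades[OF that] by (simp add: unlift_grades_def delete_row_def)
  have A_graded: "graded_matrix P ?A"
    unfolding graded_matrix_def A
  proof (intro conjI ballI impI)
    show "row_grade ?A ` J \<subseteq> P" "col_grade ?A ` I \<subseteq> P"
      using A_row A_col gen.h_in pres.relation by auto
    fix j i assume "j \<in> J" "i \<in> I" "entry ?B j i \<noteq> 0"
    then have "row_grade ?B j \<le> col_grade ?B i"
      using graph.graded_boundary_matrix rows by (auto simp: graded_matrix_def)
    then show "row_grade ?A j \<le> col_grade ?A i"
      using \<open>j \<in> J\<close> \<open>i \<in> I\<close> by (simp add: A_row A_col grades col_grades)
  qed (use gen.finite_J pres.finite_I in auto)
  have deleted: "graded_matrix (Some ` P) (delete_row 0 ?B)"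
  proof -
    have "rows (delete_row 0 ?B) = J" "cols (delete_row 0 ?B) = I"
      "row_grade (delete_row 0 ?B) = row_grade ?B" "col_grade (delete_row 0 ?B) = col_grade ?B"
      "entry (delete_row 0 ?B) = entry ?B"
      using rows gen.zero_notin_J by (auto simp: delete_row_def)
    moreover have "row_grade ?B ` J \<subseteq> Some ` P" "col_grade ?B ` I \<subseteq> Some ` P"
      using grades col_grades gen.h_in pres.relation by auto
    ultimately show ?thesis
      using graph.graded_boundary_matrix rows by (simp add: graded_matrix_def)
  qed
  \<comment> \<open>Deleting row \<open>0\<close> has the same effect as the convention that
    \<open>vertex_vec 0\<close> is zero, so an edge at \<Omega> contributes only its other
    endpoint.\<close>
  have column: "(\<Sum>j\<in>J. scale (entry ?B j i) (basis_vec j))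
      = gen.vertex_vec (f0 i) + gen.vertex_vec (f1 i)" if "i \<in> I" for i
  proof -
    have half: "(\<Sum>j\<in>J. scale (of_bool (j = a)) (basis_vec j)) = gen.vertex_vec a"
      if "a \<in> insert 0 J" for a
    proof -
      have "(\<Sum>j\<in>J. scale (of_bool (j = a)) (basis_vec j))
          = (\<Sum>j\<in>J. if j = a then basis_vec a else 0)"
        by (rule sum.cong) auto
      also have "\<dots> = gen.vertex_vec a"
        using that gen.finite_J gen.zero_notin_J
        by (auto simp: sum.delta gen.vertex_vec_def)
      finally show ?thesis .
    qed
    have "f0 i \<in> insert 0 J" "f1 i \<in> insert 0 J" using graph.faces[OF that] by auto
    then show ?thesis
      by (simp only: graph.entry_boundary_matrix F2.scale_left_distrib sum.distrib half)
  qed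
  \<comment> \<open>The matrix columns agree with \<open>rel\<close> only on \<open>I\<close>.
    Passing to \<open>rel'\<close> in the locale makes the presenting map literally equal to
    \<open>matrix_morphism\<close>, also off the index set.\<close>
  define rel' where "rel' i = (\<Sum>j\<in>J. scale (entry ?B j i) (basis_vec j))" for i
  have "presented_module P ?M ?X ?\<tau> J h s old new I g rel'"
  proof -
    have "rel' i = rel i" if "i \<in> I" for i
      using column[OF that] f(3)[OF that] by (simp add: rel'_def)
    then have "bij_betw (\<lambda>i. (g i, rel' i)) I (SIGMA x:P. new x)"
      using pres.bij_relations by (simp cong: bij_betw_cong)
    then show ?thesis
      using pres.presented_module_axioms
      unfolding presented_module_def presented_module_axioms_def by blast
  qed
  then have "minimal_projective_presentation P ?M J h I g (\<lambda>x. linear_extension rel')"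
    by (rule presented_module.minimal_presentation)
  moreover have "matrix_morphism ?A = (\<lambda>x. linear_extension rel')"
    unfolding matrix_morphism_def A rel'_def ..
  moreover have "minimal_projective_presentation P ?M J (row_grade ?A) I (col_grade ?A) q
      = minimal_projective_presentation P ?M J h I g q" for q
    by (rule minimal_projective_presentation_cong) (simp_all add: A_row A_col)
  ultimately have minimal: "minimal_presentation_matrix P ?M ?A"
    using A_graded unfolding minimal_presentation_matrix_def A by simp
  show ?thesis
  proof (intro exI[of _ graph.graph] exI[of _ 0] conjI ballI)
    show "\<exists>!x. vertex_born ?Q graph.graph v x" if "v \<in> all_verts ?Q graph.graph" for v
      using that graph.vertex_born_iff[of v] unfolding graph.all_verts by simp
    show "\<exists>!x. edge_born ?Q graph.graph i x" if "i \<in> all_edges ?Q graph.graph" for i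
      using that graph.edge_born_iff[of i] unfolding graph.all_edges by simp
    show "vertex_born ?Q graph.graph 0 None" by (simp add: graph.vertex_born_iff)
  qed (fact graph.filtered graph.graded_boundary_matrix deleted minimal)+
qed

end
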